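(* Consider a Branching Markov Chain on a countable state space $X$ with irreducible underlying Markov chain $(X,P)$ and offspring distributions $(\mu_k(x))_{k\ge1}$, $x\in X$, with constant mean offspring $m>1$, i.e. $m(x)=\sum_{k\ge1}k\mu_k(x)=m$ for all $x\in X$, where $1<m<\infty$. Let $\rho(P)$ be the spectral radius of $(X,P)$. Then the Branching Markov Chain is transient if $m\le 1/\rho(P)$, and recurrent if $m>1/\rho(P)$.
   Context: Let $X$ be a countable set and $P=(p(x,y))_{x,y\in X}$ an irreducible stochastic transition kernel on $X$, with $n$-step transition probabilities $p^{(n)}(x,y)$. The spectral radius is $\rho(P):=\limsup_{n\to\infty}p^{(n)}(x,y)^{1/n}\in(0,1]$, which by irreducibility does not depend on $x,y\in X$. For each $x\in X$ let $\mu_1(x),\mu_2(x),\ldots$ be non-negative numbers with $\sum_{k=1}^\infty\mu_k(x)=1$ and $m(x):=\sum_{k=1}^\infty k\mu_k(x)<\infty$ (so every particle has at least one offspring). The distributions $(\mu_k(x))_k$ may differ for different $x$. Branching Markov Chain (BMC): at time $0$ there is one particle at a starting position $x_s\in X$. At each time step, each particle, being at some position $x$, generates $k$ offspring particles at $x$ with probability $\mu_k(x)$ ($k=1,2,\ldots$) and dies; each of the offspring particles then moves independently one step according to $P$. All particles branch and move independently of the other particles and of the previous history of the process. Let $\eta(n)$ be the number of particles at time $n$ and $x_1(n),\ldots,x_{\eta(n)}(n)$ their positions. Write $\mathbb{P}_x$ for the law of the process started with $x_s=x$, and set $$\alpha(x)=\mathbb{P}_x\Big(\sum_{n=1}^\infty\sum_{i=1}^{\eta(n)}\mathbf{1}_{\{x_i(n)=x\}}=\infty\Big).$$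 Exactly one of three regimes occurs: $\alpha(x)=0$ for all $x\in X$; $0<\alpha(x)<1$ for all $x\in X$; or $\alpha(x)=1$ for all $x\in X$. The BMC is called transient if $\alpha(x)=0$ for all $x\in X$, and recurrent if it is not transient, i.e. if either $0<\alpha(x)<1$ for all $x\in X$ or $\alpha(x)=1$ for all $x\in X$. *)

theory Defs
  imports "HOL-Probability.Probability"
begin

primrec nstep :: "('a \<Rightarrow> 'a pmf) \<Rightarrow> nat \<Rightarrow> 'a \<Rightarrow> 'a pmf" where
  "nstep P 0 x = return_pmf x"
| "nstep P (Suc n) x = bind_pmf (P x) (nstep P n)"

definition irreducible_kernel :: "('a \<Rightarrow> 'a pmf) \<Rightarrow> bool" where
  "irreducible_kernel P \<longleftrightarrow> (\<forall>x y. \<exists>n. pmf (nstep P n x) y > 0)"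

(* The terms of the sequence lie in [0,1], so the limsup is finite and the conversion from
   ereal loses nothing. For irreducible P the value does not depend on x and y. *)
definition spectral_radius :: "('a \<Rightarrow> 'a pmf) \<Rightarrow> 'a \<Rightarrow> 'a \<Rightarrow> real" where
  "spectral_radius P x y =
     real_of_ereal (limsup (\<lambda>n. ereal (root n (pmf (nstep P n x) y))))"

(* Law of the list of positions of the children of a particle located at x. *)
definition brood :: "('a \<Rightarrow> 'a pmf) \<Rightarrow> ('a \<Rightarrow> nat pmf) \<Rightarrow> 'a \<Rightarrow> 'a list pmf" where
  "brood P \<mu> x = bind_pmf (\<mu> x) (\<lambda>k. replicate_pmf k (P x))"

(* Particles carry Ulam-Harris labels: [] is the initial particle, and i # u is the i-th child
   of u. Independently for every label u and every site y, the coordinate \<omega> (u, y) is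
   the brood that particle u produces in case it is located at y. *)
definition bmc_space ::
  "('a \<Rightarrow> 'a pmf) \<Rightarrow> ('a \<Rightarrow> nat pmf) \<Rightarrow> (nat list \<times> 'a \<Rightarrow> 'a list) measure" where
  "bmc_space P \<mu> = Pi\<^sub>M UNIV (\<lambda>(u, y). measure_pmf (brood P \<mu> y))"

(* The particles alive at time n, with their positions, when the process is started at x. *)
primrec particles ::
  "(nat list \<times> 'a \<Rightarrow> 'a list) \<Rightarrow> 'a \<Rightarrow> nat \<Rightarrow> (nat list \<times> 'a) list" where
  "particles \<omega> x 0 = [([], x)]"
| "particles \<omega> x (Suc n) =
     concat (map (\<lambda>(u, y). map (\<lambda>i. (i # u, \<omega> (u, y) ! i)) [0..<length (\<omega> (u, y))])
       (particles \<omega> x n))"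

definition num_particles :: "(nat list \<times> 'a \<Rightarrow> 'a list) \<Rightarrow> 'a \<Rightarrow> nat \<Rightarrow> nat" where
  "num_particles \<omega> x n = length (particles \<omega> x n)"

definition particle_pos :: "(nat list \<times> 'a \<Rightarrow> 'a list) \<Rightarrow> 'a \<Rightarrow> nat \<Rightarrow> nat \<Rightarrow> 'a" where
  "particle_pos \<omega> x n i = snd (particles \<omega> x n ! i)"

definition visits :: "(nat list \<times> 'a \<Rightarrow> 'a list) \<Rightarrow> 'a \<Rightarrow> ennreal" where
  "visits \<omega> x =
     (\<Sum>n. \<Sum>i<num_particles \<omega> x (Suc n). indicator {x} (particle_pos \<omega> x (Suc n) i))"

definition inf_return_prob :: "('a \<Rightarrow> 'a pmf) \<Rightarrow> ('a \<Rightarrow> nat pmf) \<Rightarrow> 'a \<Rightarrow> real" where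
  "inf_return_prob P \<mu> x = \<P>(\<omega> in bmc_space P \<mu>. visits \<omega> x = \<infinity>)"

definition bmc_transient :: "('a \<Rightarrow> 'a pmf) \<Rightarrow> ('a \<Rightarrow> nat pmf) \<Rightarrow> bool" where
  "bmc_transient P \<mu> \<longleftrightarrow> (\<forall>x. inf_return_prob P \<mu> x = 0)"

definition bmc_recurrent :: "('a \<Rightarrow> 'a pmf) \<Rightarrow> ('a \<Rightarrow> nat pmf) \<Rightarrow> bool" where
  "bmc_recurrent P \<mu> \<longleftrightarrow>
     (\<forall>x. 0 < inf_return_prob P \<mu> x \<and> inf_return_prob P \<mu> x < 1) \<or> (\<forall>x. inf_return_prob P \<mu> x = 1)"

(* The event defining inf_return_prob is measurable, so its measure is not a default value. *)
lemma visits_measurable: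
  fixes x :: "'a::countable"
  shows "(\<lambda>\<omega>. visits \<omega> x) \<in> borel_measurable (bmc_space P \<mu>)"
proof -
  have coord: "(\<lambda>\<omega>. \<omega> j) \<in> measurable (bmc_space P \<mu>) (count_space UNIV)" for j
  proof -
    have "(\<lambda>\<omega>. \<omega> j) \<in> measurable (bmc_space P \<mu>) ((\<lambda>(u, y). measure_pmf (brood P \<mu> y)) j)"
      unfolding bmc_space_def by (rule measurable_component_singleton) simp
    then show ?thesis
      by (cases j) (simp add: measurable_def)
  qed
  have step: "(\<lambda>\<omega>. concat (map (\<lambda>(u, y). map (\<lambda>i. (i # u, \<omega> (u, y) ! i)) [0..<length (\<omega> (u, y))]) ps))
      \<in> measurable (bmc_space P \<mu>) (count_space UNIV)" for ps :: "(nat list \<times> 'a) list"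
  proof (induction ps)
    case (Cons p ps)
    obtain u y where p: "p = (u, y)" by force
    have 1: "(\<lambda>\<omega>. (\<lambda>l. map (\<lambda>i. (i # u, l ! i)) [0..<length l]) (\<omega> (u, y)))
        \<in> measurable (bmc_space P \<mu>) (count_space UNIV)"
      by (rule measurable_compose[OF coord]) simp
    show ?case unfolding p list.map concat.simps prod.case
      by (rule measurable_compose_countable[OF _ 1])
        (rule measurable_compose[OF Cons.IH], simp)
  qed simp
  have parts: "(\<lambda>\<omega>. particles \<omega> x n) \<in> measurable (bmc_space P \<mu>) (count_space UNIV)" for n
  proof (induction n)
    case (Suc n)
    show ?case unfolding particles.simps by (rule measurable_compose_countable[OF step Suc.IH])
  qed simp
  show ?thesis
    unfolding visits_def num_particles_def particle_pos_def
  proof (rule borel_measurable_suminf_order)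
    fix n
    show "(\<lambda>\<omega>. \<Sum>i<length (particles \<omega> x (Suc n)). indicator {x} (snd (particles \<omega> x (Suc n) ! i)) :: ennreal)
        \<in> borel_measurable (bmc_space P \<mu>)"
      by (rule measurable_compose[OF parts, of "\<lambda>l. \<Sum>i<length l. indicator {x} (snd (l ! i))"]) simp
  qed
qed

end

theory Submission
  imports Defs
begin

text \<open>
  Conditioning on the brood of the initial particle shows that the probability \<open>g(y)\<close> of finitely
  many visits to \<open>x\<close>, started at \<open>y\<close>, is a fixed point of the operator
  \<open>(B q)(y) = \<Phi>\<^sub>y((P q)(y))\<close>, where \<open>\<Phi>\<^sub>y\<close> is the offspring generating function at \<open>y\<close>; the
  probabilities of avoiding \<open>x\<close> during a given set of times obey the same recursion.

  If \<open>m \<rho> \<le> 1\<close>, then \<open>F(x, x | m) \<le> 1\<close> for the first passage generating function \<open>F\<close>. With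
  \<open>h = 1 - g\<close>, the bound \<open>h \<le> m P h\<close> iterated up to the first visit to \<open>x\<close> yields
  \<open>m (P h)(x) \<le> F(x, x | m) h(x) \<le> h(x)\<close>. Since \<open>m > 1\<close>, the function \<open>\<Phi>\<^sub>x\<close> is not affine, so
  \<open>h(x) < m (P h)(x)\<close> unless \<open>h(x) = 0\<close>. This also covers the critical case.

  If \<open>m \<rho> > 1\<close>, then \<open>m\<^sup>N p\<^sup>N(x, x) > 1\<close> for some \<open>N\<close>, and linearising \<open>B\<^sup>N\<close> at the constant 1 gives
  \<open>\<delta> > 0\<close> with \<open>B\<^sup>N (1 - \<delta> 1\<^sub>x) \<le> 1 - \<delta> 1\<^sub>x\<close>. Hence \<open>x\<close> is occupied at each time \<open>k N\<close> with
  probability at least \<open>\<delta>\<close>, and \<open>\<alpha>(x) \<ge> \<delta>\<close>. That \<open>\<alpha>(x) = 1\<close> for one \<open>x\<close> forces \<open>\<alpha> = 1\<close> everywhere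
  follows from the convexity of the \<open>\<Phi>\<^sub>y\<close>.
\<close>

section \<open>The branching property\<close>

text \<open>Labels grow at the head, so the last entry names the ancestor in generation one.
  Appending \<open>i\<close> to every label therefore reads off the family of the
  \<open>i\<close>-th child of the root.\<close>

definition subtree :: "nat \<Rightarrow> (nat list \<times> 'a \<Rightarrow> 'b) \<Rightarrow> nat list \<times> 'a \<Rightarrow> 'b" where
  "subtree i \<omega> = (\<lambda>(u, y). \<omega> (u @ [i], y))"

text \<open>An arbitrary set \<open>T\<close> of times lets one recursion serve single times,
  initial segments and tails.\<close>

definition avoids :: "'a \<Rightarrow> nat set \<Rightarrow> 'a \<Rightarrow> (nat list \<times> 'a \<Rightarrow> 'a list) \<Rightarrow> bool" where
  "avoids x T y \<omega> \<longleftrightarrow> (\<forall>t\<in>T. x \<notin> snd ` set (particles \<omega> y t))"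

definition avoid_prob ::
  "('a \<Rightarrow> 'a pmf) \<Rightarrow> ('a \<Rightarrow> nat pmf) \<Rightarrow> 'a \<Rightarrow> nat set \<Rightarrow> 'a \<Rightarrow> real" where
  "avoid_prob P \<mu> x T y = measure (bmc_space P \<mu>) {\<omega>. avoids x T y \<omega>}"

definition offspring_gf :: "nat pmf \<Rightarrow> real \<Rightarrow> real" where
  "offspring_gf M s = measure_pmf.expectation M (\<lambda>k. s ^ k)"

definition branch :: "('a \<Rightarrow> 'a pmf) \<Rightarrow> ('a \<Rightarrow> nat pmf) \<Rightarrow> ('a \<Rightarrow> real) \<Rightarrow> 'a \<Rightarrow> real" where
  "branch P \<mu> q y = offspring_gf (\<mu> y) (measure_pmf.expectation (P y) q)"

lemma space_bmc [simp]: "space (bmc_space P \<mu>) = UNIV"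
  by (auto simp: bmc_space_def space_PiM PiE_def split: prod.splits)

lemma prob_space_bmc: "prob_space (bmc_space P \<mu>)"
  unfolding bmc_space_def
  by (rule prob_space_PiM) (auto simp: prob_space_measure_pmf split: prod.splits)

lemma measurable_root_brood:
  "(\<lambda>\<omega>. \<omega> j) \<in> measurable (bmc_space P \<mu>) (count_space UNIV)"
proof -
  have "(\<lambda>\<omega>. \<omega> j) \<in> measurable (bmc_space P \<mu>) ((\<lambda>(u, y). measure_pmf (brood P \<mu> y)) j)"
    unfolding bmc_space_def by (rule measurable_component_singleton) simp
  then show ?thesis
    by (cases j) (simp add: measurable_def)
qed

lemma measurable_particles:
  fixes y :: "'a::countable"
  shows "(\<lambda>\<omega>. particles \<omega> y n) \<in> measurable (bmc_space P \<mu>) (count_space UNIV)"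
proof -
  have step: "(\<lambda>\<omega>. concat (map (\<lambda>(u, y). map (\<lambda>i. (i # u, \<omega> (u, y) ! i)) [0..<length (\<omega> (u, y))]) ps))
      \<in> measurable (bmc_space P \<mu>) (count_space UNIV)" for ps :: "(nat list \<times> 'a) list"
  proof (induction ps)
    case (Cons p ps)
    obtain u y where p: "p = (u, y)" by force
    have 1: "(\<lambda>\<omega>. (\<lambda>l. map (\<lambda>i. (i # u, l ! i)) [0..<length l]) (\<omega> (u, y)))
        \<in> measurable (bmc_space P \<mu>) (count_space UNIV)"
      by (rule measurable_compose[OF measurable_root_brood]) simp
    show ?case unfolding p list.map concat.simps prod.case
      by (rule measurable_compose_countable[OF _ 1])
        (rule measurable_compose[OF Cons.IH], simp)
  qed simp
  show ?thesis
  proof (induction n)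
    case (Suc n)
    show ?case unfolding particles.simps by (rule measurable_compose_countable[OF step Suc.IH])
  qed simp
qed

lemma sets_avoids:
  fixes x :: "'a::countable"
  shows "{\<omega>. avoids x T y \<omega>} \<in> sets (bmc_space P \<mu>)"
proof -
  have "{\<omega> \<in> space (bmc_space P \<mu>). avoids x T y \<omega>} \<in> sets (bmc_space P \<mu>)"
    unfolding avoids_def
  proof (rule sets.sets_Collect_countable_Ball)
    fix t
    have "Measurable.pred (bmc_space P \<mu>) (\<lambda>\<omega>. (\<lambda>l. x \<notin> snd ` set l) (particles \<omega> y t))"
      by (rule measurable_compose[OF measurable_particles]) simp
    then show "{\<omega> \<in> space (bmc_space P \<mu>). x \<notin> snd ` set (particles \<omega> y t)} \<in> sets (bmc_space P \<mu>)"
      by (simp add: pred_def)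
  qed
  then show ?thesis by simp
qed

text \<open>\<open>particles\<close> adds the youngest generation at the end; conditioning on the
  root's brood needs the decomposition at the oldest one instead.\<close>

lemma set_particles_Suc:
  "set (particles \<omega> y (Suc n)) =
    (\<Union>i<length (\<omega> ([], y)).
       (\<lambda>(u, z). (u @ [i], z)) ` set (particles (subtree i \<omega>) (\<omega> ([], y) ! i) n))"
proof (induction n)
  case 0
  show ?case by auto
next
  case (Suc n)
  have *: "set (particles \<omega>' y' (Suc k)) =
      (\<Union>(u, z)\<in>set (particles \<omega>' y' k). (\<lambda>i. (i # u, \<omega>' (u, z) ! i)) ` {..<length (\<omega>' (u, z))})"
    for \<omega>' :: "nat list \<times> 'a \<Rightarrow> 'a list" and y' k
    by (simp add: atLeast0LessThan case_prod_unfold)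
  show ?case
    unfolding *[of \<omega> y "Suc n"] Suc.IH
    unfolding *[of _ _ n]
    by (simp add: image_UN case_prod_unfold image_image subtree_def) blast
qed

text \<open>Time \<open>Suc t\<close> for the root is time \<open>t\<close> for its children. Their
  families say nothing about the root's own position, hence \<open>0\<close> must not lie in
  \<open>T\<close>.\<close>

lemma avoids_step:
  assumes "0 \<notin> T"
  shows "avoids x T y \<omega> \<longleftrightarrow>
    (\<forall>i<length (\<omega> ([], y)). avoids x (Suc -` T) (\<omega> ([], y) ! i) (subtree i \<omega>))"
proof -
  have "avoids x T y \<omega> \<longleftrightarrow> (\<forall>t\<in>Suc -` T. x \<notin> snd ` set (particles \<omega> y (Suc t)))"
    unfolding avoids_def using assms by (metis not0_implies_Suc vimageE vimageI)
  also have "\<dots> \<longleftrightarrow> (\<forall>t\<in>Suc -` T. \<forall>i<length (\<omega> ([], y)).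
      x \<notin> snd ` set (particles (subtree i \<omega>) (\<omega> ([], y) ! i) t))"
    unfolding set_particles_Suc by (simp add: image_UN image_image case_prod_unfold Ball_def)
  finally show ?thesis unfolding avoids_def by blast
qed

section \<open>Law and independence of the subtrees\<close>

lemma distr_shift: "distr (bmc_space P \<mu>) (bmc_space P \<mu>) (subtree i) = bmc_space P \<mu>"
proof -
  let ?M = "\<lambda>(u::nat list, y). measure_pmf (brood P \<mu> y)"
  let ?f = "\<lambda>(u, y). (u @ [i], y)"
  \<comment> \<open>Appending \<open>i\<close> is injective on labels and keeps the site, and the
    law of a coordinate depends on its site only, so reindexing preserves the product
    measure.\<close>
  have "distr (Pi\<^sub>M UNIV ?M) (\<Pi>\<^sub>M j\<in>UNIV. ?M (?f j)) (\<lambda>\<omega>. \<lambda>n\<in>UNIV. \<omega> (?f n)) = (\<Pi>\<^sub>M j\<in>UNIV. ?M (?f j))"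
    by (rule distr_PiM_reindex) (auto simp: prob_space_measure_pmf inj_on_def split: prod.splits)
  moreover have M: "(\<lambda>j. ?M (?f j)) = ?M" by auto
  moreover have S: "(\<lambda>\<omega>. \<lambda>n\<in>UNIV. \<omega> (?f n)) = subtree i"
    by (auto simp: subtree_def fun_eq_iff)
  ultimately show ?thesis unfolding bmc_space_def M S by (simp only:)
qed

lemma measurable_shift: "subtree i \<in> measurable (bmc_space P \<mu>) (bmc_space P \<mu>)"
  unfolding bmc_space_def subtree_def
  by (rule measurable_PiM_single') (auto simp: case_prod_unfold intro!: measurable_component_singleton)

lemma prob_avoids_shift:
  fixes x :: "'a::countable"
  shows "measure (bmc_space P \<mu>) {\<omega>. avoids x T y (subtree i \<omega>)} = avoid_prob P \<mu> x T y"
proof -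
  have "avoid_prob P \<mu> x T y = measure (distr (bmc_space P \<mu>) (bmc_space P \<mu>) (subtree i)) {\<omega>. avoids x T y \<omega>}"
    unfolding distr_shift avoid_prob_def ..
  also have "\<dots> = measure (bmc_space P \<mu>) (subtree i -` {\<omega>. avoids x T y \<omega>} \<inter> space (bmc_space P \<mu>))"
    by (rule measure_distr[OF measurable_shift sets_avoids])
  finally show ?thesis by (simp add: vimage_def)
qed

lemma prob_root_brood: "measure (bmc_space P \<mu>) {\<omega>. \<omega> ([], y) = l} = pmf (brood P \<mu> y) l"
proof -
  let ?M = "\<lambda>(u::nat list, y). measure_pmf (brood P \<mu> y)"
  have "distr (Pi\<^sub>M UNIV ?M) (?M ([], y)) (\<lambda>\<omega>. \<omega> ([], y)) = ?M ([], y)"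
    by (rule distr_PiM_component) (auto simp: prob_space_measure_pmf split: prod.splits)
  then have "measure (?M ([], y)) {l} = measure (distr (Pi\<^sub>M UNIV ?M) (?M ([], y)) (\<lambda>\<omega>. \<omega> ([], y))) {l}"
    by simp
  also have "\<dots> = measure (Pi\<^sub>M UNIV ?M) ((\<lambda>\<omega>. \<omega> ([], y)) -` {l} \<inter> space (Pi\<^sub>M UNIV ?M))"
    by (rule measure_distr) (rule measurable_component_singleton, auto)
  finally show ?thesis
    using space_bmc[of P \<mu>] by (simp add: bmc_space_def vimage_def pmf.rep_eq)
qed

lemma indep_coordinates:
  "prob_space.indep_vars (bmc_space P \<mu>) (\<lambda>(u::nat list, y). measure_pmf (brood P \<mu> y)) (\<lambda>j \<omega>. \<omega> j) UNIV"
proof -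
  interpret prob_space "bmc_space P \<mu>" by (rule prob_space_bmc)
  let ?M = "\<lambda>(u::nat list, y). measure_pmf (brood P \<mu> y)"
  have c: "distr (bmc_space P \<mu>) (?M j) (\<lambda>\<omega>. \<omega> j) = ?M j" for j
    unfolding bmc_space_def
    by (rule distr_PiM_component) (auto simp: prob_space_measure_pmf split: prod.splits)
  show ?thesis
  proof (subst indep_vars_iff_distr_eq_PiM')
    show "(\<lambda>\<omega>. \<omega> j) \<in> measurable (bmc_space P \<mu>) (?M j)" for j
      unfolding bmc_space_def by (rule measurable_component_singleton) simp
    show "distr (bmc_space P \<mu>) (Pi\<^sub>M UNIV ?M) (\<lambda>\<omega>. \<lambda>j\<in>UNIV. \<omega> j) =
      (\<Pi>\<^sub>M j\<in>UNIV. distr (bmc_space P \<mu>) (?M j) (\<lambda>\<omega>. \<omega> j))"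
      unfolding c restrict_UNIV by (simp add: bmc_space_def distr_id[unfolded id_def])
  qed auto
qed

text \<open>Subtrees of different children of the root use disjoint sets of coordinates.\<close>

lemma prob_avoids_root_brood:
  fixes x :: "'a::countable"
  shows "measure (bmc_space P \<mu>)
      {\<omega>. \<omega> ([], y) = l \<and> (\<forall>i<length l. avoids x T (l ! i) (subtree i \<omega>))} =
    pmf (brood P \<mu> y) l * (\<Prod>i<length l. avoid_prob P \<mu> x T (l ! i))"
proof -
  interpret prob_space "bmc_space P \<mu>" by (rule prob_space_bmc)
  let ?M = "\<lambda>(u::nat list, y). measure_pmf (brood P \<mu> y)"
  \<comment> \<open>Block 0 is the root's coordinate at \<open>y\<close>; block \<open>Suc i\<close>
    consists of the labels ending in \<open>i\<close>, exactly those that \<open>subtree i\<close>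
    reads.\<close>
  define K where "K j = (case j of 0 \<Rightarrow> {([], y)} | Suc i \<Rightarrow> {(u @ [i], z) |u z. True})"
    for j :: nat
  \<comment> \<open>The starting points \<open>l ! i\<close> come from the fixed list
    \<open>l\<close>, not from the random brood, so each event depends on its own block
    alone.\<close>
  define A where "A j = (case j of
      0 \<Rightarrow> {\<omega> \<in> space (Pi\<^sub>M (K 0) ?M). \<omega> ([], y) = l}
    | Suc i \<Rightarrow> {\<omega> \<in> space (Pi\<^sub>M (K (Suc i)) ?M). avoids x T (l ! i) (subtree i \<omega>)})" for j
  have ind: "indep_vars (\<lambda>j. Pi\<^sub>M (K j) ?M) (\<lambda>j \<omega>. restrict \<omega> (K j)) UNIV"
  proof (rule indep_vars_restrict[OF indep_coordinates])
    show "disjoint_family_on K UNIV"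
      by (auto simp: disjoint_family_on_def K_def split: nat.splits)
  qed auto
  have A_sets: "A j \<in> sets (Pi\<^sub>M (K j) ?M)" for j
  proof (cases j)
    case 0
    have "(\<lambda>\<omega>. \<omega> ([], y)) \<in> measurable (Pi\<^sub>M (K 0) ?M) (?M ([], y))"
      by (rule measurable_component_singleton) (simp add: K_def)
    then have "Measurable.pred (Pi\<^sub>M (K 0) ?M) (\<lambda>\<omega>. (\<lambda>l'. l' = l) (\<omega> ([], y)))"
      by (rule measurable_compose) simp
    then show ?thesis unfolding 0 A_def by (simp add: pred_def)
  next
    case (Suc i)
    have "subtree i \<in> measurable (Pi\<^sub>M (K (Suc i)) ?M) (bmc_space P \<mu>)"
      unfolding bmc_space_def subtree_def
    proof (rule measurable_PiM_single')
      fix j :: "nat list \<times> 'a"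
      have "(\<lambda>\<omega>. \<omega> (fst j @ [i], snd j)) \<in> measurable (Pi\<^sub>M (K (Suc i)) ?M) (?M (fst j @ [i], snd j))"
        by (rule measurable_component_singleton) (simp add: K_def)
      then show "(\<lambda>\<omega>. case j of (u, y) \<Rightarrow> \<omega> (u @ [i], y)) \<in> measurable (Pi\<^sub>M (K (Suc i)) ?M) (?M j)"
        by (simp add: case_prod_unfold)
    qed (auto split: prod.splits)
    then have "Measurable.pred (Pi\<^sub>M (K (Suc i)) ?M) (\<lambda>\<omega>. avoids x T (l ! i) (subtree i \<omega>))"
      by (rule measurable_compose) (use sets_avoids[of x T "l ! i" P \<mu>] in \<open>simp add: pred_def\<close>)
    then show ?thesis unfolding Suc A_def by (simp add: pred_def)
  qed
  have in_sp: "restrict \<omega> (K j) \<in> space (Pi\<^sub>M (K j) ?M)" for \<omega> j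
    by (auto simp: space_PiM split: prod.splits)
  have sub: "subtree i (restrict \<omega> (K (Suc i))) = subtree i \<omega>" for i and \<omega> :: "nat list \<times> 'a \<Rightarrow> 'a list"
    by (auto simp: subtree_def K_def fun_eq_iff)
  have "restrict \<omega> (K 0) ([], y) = \<omega> ([], y)" for \<omega> :: "nat list \<times> 'a \<Rightarrow> 'a list"
    by (simp add: K_def)
  then have pre: "(\<lambda>\<omega>. restrict \<omega> (K j)) -` A j \<inter> space (bmc_space P \<mu>) =
      (case j of 0 \<Rightarrow> {\<omega>. \<omega> ([], y) = l} | Suc i \<Rightarrow> {\<omega>. avoids x T (l ! i) (subtree i \<omega>)})" for j
    using in_sp[of _ j] by (cases j) (simp_all add: A_def vimage_def sub)
  have "prob (\<Inter>j\<in>{..length l}. (\<lambda>\<omega>. restrict \<omega> (K j)) -` A j \<inter> space (bmc_space P \<mu>)) =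
      (\<Prod>j\<le>length l. prob ((\<lambda>\<omega>. restrict \<omega> (K j)) -` A j \<inter> space (bmc_space P \<mu>)))"
    by (rule indep_varsD[OF ind]) (auto simp: A_sets)
  moreover have "(\<Inter>j\<in>{..length l}. (\<lambda>\<omega>. restrict \<omega> (K j)) -` A j \<inter> space (bmc_space P \<mu>)) =
      {\<omega>. \<omega> ([], y) = l \<and> (\<forall>i<length l. avoids x T (l ! i) (subtree i \<omega>))}"
    unfolding pre lessThan_Suc_atMost[symmetric] lessThan_Suc_eq_insert_0 by auto
  moreover have "(\<Prod>j\<le>length l. prob ((\<lambda>\<omega>. restrict \<omega> (K j)) -` A j \<inter> space (bmc_space P \<mu>))) =
      pmf (brood P \<mu> y) l * (\<Prod>i<length l. avoid_prob P \<mu> x T (l ! i))"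
    unfolding pre
    by (simp add: prod.atMost_shift prob_root_brood prob_avoids_shift)
  ultimately show ?thesis by simp
qed

section \<open>The recursion for avoidance probabilities\<close>

lemma nn_integral_replicate_pmf:
  fixes f :: "'a \<Rightarrow> ennreal"
  shows "(\<integral>\<^sup>+l. (\<Prod>i<length l. f (l ! i)) \<partial>replicate_pmf k p) = (\<integral>\<^sup>+z. f z \<partial>p) ^ k"
proof (induction k)
  case (Suc k)
  show ?case
    by (simp add: prod.lessThan_Suc_shift nn_integral_cmult nn_integral_multc Suc.IH del: prod.lessThan_Suc)
qed simp

lemma avoid_prob_nonneg [simp]: "0 \<le> avoid_prob P \<mu> x T y"
  by (simp add: avoid_prob_def)

lemma avoid_prob_le_1 [simp]: "avoid_prob P \<mu> x T y \<le> 1"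
proof -
  interpret prob_space "bmc_space P \<mu>" by (rule prob_space_bmc)
  show ?thesis by (simp add: avoid_prob_def)
qed

lemma integrable_pmf_bounded:
  fixes f :: "'a \<Rightarrow> real"
  assumes "\<And>z. \<bar>f z\<bar> \<le> B"
  shows "integrable (measure_pmf p) f"
  by (rule measure_pmf.integrable_const_bound[where B = B]) (use assms in auto)

lemma expectation_unit_interval:
  fixes q :: "'a \<Rightarrow> real"
  assumes "\<And>z. 0 \<le> q z" "\<And>z. q z \<le> 1"
  shows "0 \<le> measure_pmf.expectation p q" "measure_pmf.expectation p q \<le> 1"
    "integrable (measure_pmf p) q"
proof -
  show i: "integrable (measure_pmf p) q"
    by (rule integrable_pmf_bounded[where B = 1]) (use assms in \<open>auto simp: abs_le_iff intro: order_trans[of _ 0]\<close>)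
  show "0 \<le> measure_pmf.expectation p q" using assms by simp
  show "measure_pmf.expectation p q \<le> 1"
    by (rule measure_pmf.integral_le_const[OF i]) (use assms in auto)
qed

text \<open>Split according to the root's brood \<open>l\<close>, one of countably many lists. Given
  \<open>l\<close>, the families of the children are independent; averaging the product over
  \<open>k\<close> independent moves gives a \<open>k\<close>-th power, and averaging over
  \<open>k\<close> the generating function.\<close>

lemma avoid_prob_step:
  fixes x :: "'a::countable"
  assumes "0 \<notin> T"
  shows "avoid_prob P \<mu> x T y = branch P \<mu> (avoid_prob P \<mu> x (Suc -` T)) y"
proof -
  interpret prob_space "bmc_space P \<mu>" by (rule prob_space_bmc)
  let ?q = "avoid_prob P \<mu> x (Suc -` T)"
  let ?E = "\<lambda>l. {\<omega>. \<omega> ([], y) = l \<and> (\<forall>i<length l. avoids x (Suc -` T) (l ! i) (subtree i \<omega>))}"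
  have E_eq: "?E l = {\<omega> \<in> space (bmc_space P \<mu>). \<omega> ([], y) = l} \<inter> {\<omega>. avoids x T y \<omega>}" for l
  proof (rule set_eqI)
    fix \<omega>
    show "\<omega> \<in> ?E l \<longleftrightarrow> \<omega> \<in> {\<omega> \<in> space (bmc_space P \<mu>). \<omega> ([], y) = l} \<inter> {\<omega>. avoids x T y \<omega>}"
      using avoids_step[OF assms, of x y \<omega>] by (cases "\<omega> ([], y) = l") simp_all
  qed
  have E_sets: "?E l \<in> sets (bmc_space P \<mu>)" for l
    unfolding E_eq
    by (intro sets.Int sets_avoids measurable_sets_Collect[OF measurable_root_brood[of "([], y)"]]) auto
  have "ennreal (avoid_prob P \<mu> x T y) = emeasure (bmc_space P \<mu>) (\<Union>l\<in>UNIV. ?E l)"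
    unfolding E_eq avoid_prob_def emeasure_eq_measure[symmetric]
    by (rule arg_cong[where f = "emeasure _"]) auto
  also have "\<dots> = (\<integral>\<^sup>+l. emeasure (bmc_space P \<mu>) (?E l) \<partial>count_space UNIV)"
    by (rule emeasure_UN_countable) (auto simp: E_sets disjoint_family_on_def)
  also have "\<dots> = (\<integral>\<^sup>+l. ennreal (pmf (brood P \<mu> y) l) * (\<Prod>i<length l. ennreal (?q (l ! i))) \<partial>count_space UNIV)"
    by (simp add: emeasure_eq_measure prob_avoids_root_brood ennreal_mult prod_nonneg prod_ennreal)
  also have "\<dots> = (\<integral>\<^sup>+l. (\<Prod>i<length l. ennreal (?q (l ! i))) \<partial>brood P \<mu> y)"
    by (rule nn_integral_measure_pmf[symmetric])
  also have "\<dots> = (\<integral>\<^sup>+k. (\<integral>\<^sup>+z. ennreal (?q z) \<partial>P y) ^ k \<partial>\<mu> y)"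
    unfolding brood_def by (simp add: nn_integral_replicate_pmf[where f = "\<lambda>z. ennreal (?q z)"])
  also have "(\<integral>\<^sup>+z. ennreal (?q z) \<partial>P y) = ennreal (measure_pmf.expectation (P y) ?q)"
    by (rule nn_integral_eq_integral) (auto intro: expectation_unit_interval)
  also have "(\<integral>\<^sup>+k. ennreal (measure_pmf.expectation (P y) ?q) ^ k \<partial>\<mu> y) = ennreal (branch P \<mu> ?q y)"
  proof -
    have "0 \<le> measure_pmf.expectation (P y) ?q" "measure_pmf.expectation (P y) ?q \<le> 1"
      by (auto intro!: expectation_unit_interval)
    then have "(\<integral>\<^sup>+k. ennreal (measure_pmf.expectation (P y) ?q) ^ k \<partial>\<mu> y) =
        (\<integral>\<^sup>+k. ennreal (measure_pmf.expectation (P y) ?q ^ k) \<partial>\<mu> y)"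
      by (simp add: ennreal_power)
    also have "\<dots> = ennreal (branch P \<mu> ?q y)"
      unfolding branch_def offspring_gf_def
      by (rule nn_integral_eq_integral)
        (auto intro!: expectation_unit_interval power_le_one)
    finally show ?thesis .
  qed
  finally show ?thesis
    by (simp add: branch_def offspring_gf_def)
qed

text \<open>Disposes of time 0, which \<open>avoid_prob_step\<close> excludes.\<close>

lemma avoid_prob_0:
  assumes "0 \<in> T"
  shows "avoid_prob P \<mu> x T y = (if y = x then 0 else avoid_prob P \<mu> x (T - {0}) y)"
proof -
  have "avoids x T y \<omega> \<longleftrightarrow> y \<noteq> x \<and> avoids x (T - {0}) y \<omega>" for \<omega>
  proof -
    have "(\<forall>t\<in>T. Q t) \<longleftrightarrow> Q 0 \<and> (\<forall>t\<in>T - {0}. Q t)" for Q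
      using assms by blast
    from this[of "\<lambda>t. x \<notin> snd ` set (particles \<omega> y t)"] show ?thesis
      unfolding avoids_def by auto
  qed
  then show ?thesis by (simp add: avoid_prob_def)
qed

section \<open>Offspring generating functions and finitely many visits\<close>

lemma expectation_of_nat_pmf:
  fixes M :: "nat pmf"
  assumes "(\<lambda>k. real k * pmf M k) sums m"
  shows "integrable (measure_pmf M) real" "measure_pmf.expectation M real = m"
proof -
  have i: "integrable (count_space UNIV) (\<lambda>k. pmf M k *\<^sub>R real k)"
    using assms by (simp add: integrable_count_space_nat_iff sums_iff mult.commute)
  then show "integrable (measure_pmf M) real"
    unfolding measure_pmf_eq_density by (subst integrable_density) auto
  have "measure_pmf.expectation M real = (\<integral>k. pmf M k *\<^sub>R real k \<partial>count_space UNIV)"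
    unfolding measure_pmf_eq_density by (subst integral_density) auto
  also have "\<dots> = m"
    using integral_count_space_nat[OF i] assms by (simp add: sums_iff mult.commute)
  finally show "measure_pmf.expectation M real = m" .
qed

lemma integrable_offspring_gf:
  fixes s :: real
  assumes "0 \<le> s" "s \<le> 1"
  shows "integrable (measure_pmf M) (\<lambda>k. s ^ k)"
  by (rule integrable_pmf_bounded[where B = 1]) (use assms in \<open>auto simp: power_le_one\<close>)

lemma offspring_gf_nonneg: "0 \<le> s \<Longrightarrow> 0 \<le> offspring_gf M s"
  by (simp add: offspring_gf_def)

lemma offspring_gf_mono:
  assumes "0 \<le> s" "s \<le> t" "t \<le> 1"
  shows "offspring_gf M s \<le> offspring_gf M t"
  unfolding offspring_gf_def
  by (rule integral_mono) (use assms in \<open>auto intro!: integrable_offspring_gf power_mono\<close>)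

lemma offspring_gf_1 [simp]: "offspring_gf M 1 = 1"
  by (simp add: offspring_gf_def)

lemma offspring_gf_le_1: "0 \<le> s \<Longrightarrow> s \<le> 1 \<Longrightarrow> offspring_gf M s \<le> 1"
  using offspring_gf_mono[of s 1 M] by simp

lemma offspring_gf_le_self:
  assumes "pmf M 0 = 0" "0 \<le> s" "s \<le> 1"
  shows "offspring_gf M s \<le> s"
proof -
  have "offspring_gf M s \<le> measure_pmf.expectation M (\<lambda>_. s)"
    unfolding offspring_gf_def
  proof (rule integral_mono_AE)
    show "AE k in M. s ^ k \<le> s"
    proof (rule AE_pmfI)
      fix k assume "k \<in> set_pmf M"
      with assms(1) have "1 \<le> k" by (metis One_nat_def Suc_leI neq0_conv set_pmf_iff)
      then show "s ^ k \<le> s" using power_decreasing[of 1 k s] assms by simp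
    qed
  qed (use assms in \<open>auto intro: integrable_offspring_gf\<close>)
  then show ?thesis by simp
qed

lemma offspring_gf_eq_0:
  assumes "offspring_gf M s = 0" "0 \<le> s" "s \<le> 1"
  shows "s = 0"
proof (rule ccontr)
  assume "s \<noteq> 0"
  have "AE k in M. s ^ k = 0"
    using assms integral_nonneg_eq_0_iff_AE[OF integrable_offspring_gf[of s M]]
    by (auto simp: offspring_gf_def)
  then show False
    using \<open>s \<noteq> 0\<close> set_pmf_not_empty[of M] by (auto simp: AE_measure_pmf_iff)
qed

text \<open>Convexity between \<open>s\<close> and 1, where the generating function equals 1. For a
  single power it follows by induction on \<open>k\<close>, with defect a (1 - a) (1 - s) (1 - s^k)
  in each step.\<close>

lemma offspring_gf_convex:
  assumes "0 \<le> a" "a \<le> 1" "0 \<le> s" "s \<le> 1"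
  shows "offspring_gf M (a + (1 - a) * s) \<le> a + (1 - a) * offspring_gf M s"
proof -
  have r: "0 \<le> a + (1 - a) * s" "a + (1 - a) * s \<le> 1"
    using assms mult_left_le[of s "1 - a"] by auto
  have "(a + (1 - a) * s) ^ k \<le> a + (1 - a) * s ^ k" for k
  proof (induction k)
    case (Suc k)
    have "(a + (1 - a) * s) ^ Suc k \<le> (a + (1 - a) * s) * (a + (1 - a) * s ^ k)"
      using Suc.IH r by (simp add: mult_left_mono)
    also have "\<dots> = a + (1 - a) * s ^ Suc k - a * (1 - a) * ((1 - s) * (1 - s ^ k))"
      by (simp add: algebra_simps)
    also have "\<dots> \<le> a + (1 - a) * s ^ Suc k"
      using assms by (simp add: power_le_one)
    finally show ?case .
  qed simp
  then have "offspring_gf M (a + (1 - a) * s) \<le> measure_pmf.expectation M (\<lambda>k. a + (1 - a) * s ^ k)"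
    unfolding offspring_gf_def
    by (intro integral_mono) (use assms r in \<open>auto intro!: integrable_offspring_gf\<close>)
  also have "\<dots> = a + (1 - a) * offspring_gf M s"
    unfolding offspring_gf_def using assms by (simp add: integrable_offspring_gf)
  finally show ?thesis .
qed

lemma offspring_gf_tendsto:
  assumes "X \<longlonglongrightarrow> s" "\<And>n. 0 \<le> X n" "\<And>n. X n \<le> 1"
  shows "(\<lambda>n. offspring_gf M (X n)) \<longlonglongrightarrow> offspring_gf M s"
  unfolding offspring_gf_def
  by (rule integral_dominated_convergence[where w = "\<lambda>_. 1"])
     (use assms in \<open>auto intro!: tendsto_power simp: power_le_one\<close>)

text \<open>The slope of the chord of the generating function between \<open>s\<close> and 1, in a form that
  remains meaningful at \<open>s = 1\<close>, where it is the mean.\<close>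

definition gf_slope :: "nat pmf \<Rightarrow> real \<Rightarrow> real" where
  "gf_slope M s = measure_pmf.expectation M (\<lambda>k. \<Sum>i<k. s ^ i)"

lemma sum_power_le_of_nat:
  fixes s :: real
  assumes "0 \<le> s" "s \<le> 1"
  shows "(\<Sum>i<k. s ^ i) \<le> real k"
  using sum_bounded_above[of "{..<k}" "\<lambda>i. s ^ i" 1] assms by (simp add: power_le_one)

lemma one_minus_offspring_gf:
  assumes "0 \<le> s" "s \<le> 1"
  shows "1 - offspring_gf M s = (1 - s) * gf_slope M s"
proof -
  have "1 - offspring_gf M s = measure_pmf.expectation M (\<lambda>k. 1 - s ^ k)"
    unfolding offspring_gf_def using assms by (simp add: integrable_offspring_gf)
  also have "\<dots> = measure_pmf.expectation M (\<lambda>k. (1 - s) * (\<Sum>i<k. s ^ i))"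
    by (simp add: one_diff_power_eq)
  finally show ?thesis by (simp add: gf_slope_def)
qed

lemma integrable_gf_slope:
  assumes "integrable (measure_pmf M) real" "0 \<le> s" "s \<le> 1"
  shows "integrable (measure_pmf M) (\<lambda>k. \<Sum>i<k. s ^ i :: real)"
  by (rule Bochner_Integration.integrable_bound[OF assms(1)])
     (use assms sum_power_le_of_nat in \<open>auto intro!: AE_pmfI simp: sum_nonneg\<close>)

lemma gf_slope_le_mean:
  assumes "integrable (measure_pmf M) real" "0 \<le> s" "s \<le> 1"
  shows "gf_slope M s \<le> measure_pmf.expectation M real"
  unfolding gf_slope_def
  by (rule integral_mono) (use assms in \<open>auto intro: integrable_gf_slope sum_power_le_of_nat\<close>)

text \<open>Equality would force the sum of \<open>s ^ i\<close> over i < k to be \<open>k\<close>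
  almost surely. As s < 1 this fails for every k \<ge> 2, so there would be at most one child and
  the mean could not exceed 1.\<close>

lemma gf_slope_less_mean:
  assumes "integrable (measure_pmf M) real" "1 < measure_pmf.expectation M real" "0 \<le> s" "s < 1"
  shows "gf_slope M s < measure_pmf.expectation M real"
proof (rule ccontr)
  note int = integrable_gf_slope[OF assms(1,3) less_imp_le[OF assms(4)]]
  assume "\<not> gf_slope M s < measure_pmf.expectation M real"
  with gf_slope_le_mean[of M s] assms
  have "measure_pmf.expectation M (\<lambda>k. real k - (\<Sum>i<k. s ^ i)) = 0"
    using int by (simp add: gf_slope_def)
  moreover have "integrable (measure_pmf M) (\<lambda>k. real k - (\<Sum>i<k. s ^ i))"
    using int assms by simp
  ultimately have AE: "AE k in M. real k - (\<Sum>i<k. s ^ i) = 0"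
    using integral_nonneg_eq_0_iff_AE[of M "\<lambda>k. real k - (\<Sum>i<k. s ^ i)"]
      sum_power_le_of_nat[of s] assms by simp
  have "AE k in M. real k \<le> 1"
  proof (rule AE_pmfI)
    fix k assume k: "k \<in> set_pmf M"
    show "real k \<le> 1"
    proof (rule ccontr)
      assume "\<not> real k \<le> 1"
      then have "2 \<le> k" by simp
      then obtain j where j: "k = Suc (Suc j)" by (metis add_2_eq_Suc le_Suc_ex)
      have "(\<Sum>i<k. s ^ i) = 1 + s * (\<Sum>i<Suc j. s ^ i)"
        unfolding j sum.lessThan_Suc_shift[of _ "Suc j"] by (simp add: sum_distrib_left distrib_left)
      also have "\<dots> \<le> 1 + s * real (Suc j)"
        using sum_power_le_of_nat[of s "Suc j"] assms by (simp add: mult_left_mono del: sum.lessThan_Suc)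
      also have "\<dots> < 1 + 1 * real (Suc j)"
        using assms by (intro add_strict_left_mono mult_strict_right_mono) auto
      finally show False using AE k j by (auto simp: AE_measure_pmf_iff)
    qed
  qed
  then have "measure_pmf.expectation M real \<le> 1"
    by (rule measure_pmf.integral_le_const[OF assms(1)])
  then show False using assms by simp
qed

text \<open>The left derivative of the generating function at 1 is the mean; integrability of the
  offspring number provides the dominating function.\<close>

lemma gf_slope_tendsto_mean:
  assumes "integrable (measure_pmf M) real"
    and "X \<longlonglongrightarrow> 1" "\<And>n. 0 \<le> X n" "\<And>n. X n \<le> 1"
  shows "(\<lambda>n. gf_slope M (X n)) \<longlonglongrightarrow> measure_pmf.expectation M real"
  unfolding gf_slope_def
proof (rule integral_dominated_convergence[where w = real])
  show "AE k in M. (\<lambda>n. \<Sum>i<k. X n ^ i) \<longlonglongrightarrow> real k"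
  proof (rule AE_pmfI)
    fix k
    have "(\<lambda>n. \<Sum>i<k. X n ^ i) \<longlonglongrightarrow> (\<Sum>i<k. 1 ^ i)"
      by (intro tendsto_sum tendsto_power assms)
    then show "(\<lambda>n. \<Sum>i<k. X n ^ i) \<longlonglongrightarrow> real k" by simp
  qed
  show "AE k in M. norm (\<Sum>i<k. X n ^ i) \<le> real k" for n
    using sum_power_le_of_nat[OF assms(3,4)] assms(3) by (auto simp: sum_nonneg)
qed (use assms in auto)

lemma branch_mono:
  assumes "\<And>z. 0 \<le> q z" "\<And>z. q z \<le> r z" "\<And>z. r z \<le> 1"
  shows "branch P \<mu> q y \<le> branch P \<mu> r y"
proof -
  have q1: "q z \<le> 1" and r0: "0 \<le> r z" for z using assms order_trans by blast+
  show ?thesis unfolding branch_def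
    by (intro offspring_gf_mono integral_mono expectation_unit_interval) (use assms q1 r0 in auto)
qed

lemma branch_unit_interval:
  assumes "\<And>z. 0 \<le> q z" "\<And>z. q z \<le> 1"
  shows "0 \<le> branch P \<mu> q y" "branch P \<mu> q y \<le> 1"
  unfolding branch_def using assms
  by (auto intro!: offspring_gf_nonneg offspring_gf_le_1 expectation_unit_interval)

lemma branch_tendsto:
  assumes "\<And>z. (\<lambda>n. q n z) \<longlonglongrightarrow> r z" "\<And>n z. 0 \<le> q n z" "\<And>n z. q n z \<le> 1"
  shows "(\<lambda>n. branch P \<mu> (q n) y) \<longlonglongrightarrow> branch P \<mu> r y"
  unfolding branch_def
proof (intro offspring_gf_tendsto expectation_unit_interval)
  show "(\<lambda>n. measure_pmf.expectation (P y) (q n)) \<longlonglongrightarrow> measure_pmf.expectation (P y) r"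
    by (rule integral_dominated_convergence[where w = "\<lambda>_. 1"]) (use assms in auto)
qed (use assms in auto)

section \<open>Finitely many visits as a limit of avoidance events\<close>

definition finite_visits_prob ::
  "('a \<Rightarrow> 'a pmf) \<Rightarrow> ('a \<Rightarrow> nat pmf) \<Rightarrow> 'a \<Rightarrow> 'a \<Rightarrow> real" where
  "finite_visits_prob P \<mu> x y = measure (bmc_space P \<mu>) {\<omega>. \<exists>n. avoids x {n..} y \<omega>}"

text \<open>Each generation is finite and contributes an integer, so the total is finite exactly
  when the contributions eventually vanish: the terms of a convergent series drop below 1 and are
  then 0.\<close>

lemma visits_eq_infinity_iff: "visits \<omega> x = \<infinity> \<longleftrightarrow> \<not> (\<exists>n. avoids x {n..} x \<omega>)"
proof -
  define c where "c n = card {i. i < num_particles \<omega> x n \<and> particle_pos \<omega> x n i = x}" for n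
  have c0: "c n = 0 \<longleftrightarrow> x \<notin> snd ` set (particles \<omega> x n)" for n
    unfolding c_def num_particles_def particle_pos_def
    by simp (metis (no_types, opaque_lifting) imageE imageI in_set_conv_nth)
  have v: "visits \<omega> x = (\<Sum>n. ennreal (real (c (Suc n))))"
    unfolding visits_def c_def
    by (intro suminf_cong) (auto simp: indicator_def sum.If_cases Int_def lessThan_def ennreal_of_nat_eq_real_of_nat)
  show ?thesis
  proof
    assume inf: "visits \<omega> x = \<infinity>"
    show "\<not> (\<exists>n. avoids x {n..} x \<omega>)"
    proof
      assume "\<exists>n. avoids x {n..} x \<omega>"
      then obtain N where "c n = 0" if "n \<ge> N" for n
        unfolding c0 avoids_def by auto
      then have "visits \<omega> x = (\<Sum>n<N. ennreal (real (c (Suc n))))"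
        unfolding v by (intro suminf_finite) auto
      then show False using inf by (simp add: sum_ennreal)
    qed
  next
    assume A: "\<not> (\<exists>n. avoids x {n..} x \<omega>)"
    show "visits \<omega> x = \<infinity>"
    proof (rule ccontr)
      assume "visits \<omega> x \<noteq> \<infinity>"
      then have "summable (\<lambda>n. real (c (Suc n)))"
        unfolding v by (intro summable_suminf_not_top) auto
      then have "(\<lambda>n. real (c (Suc n))) \<longlonglongrightarrow> 0" by (rule summable_LIMSEQ_zero)
      then have "eventually (\<lambda>n. real (c (Suc n)) < 1) sequentially"
        by (rule order_tendstoD) simp
      then obtain N where N: "real (c (Suc n)) < 1" if "n \<ge> N" for n
        unfolding eventually_sequentially by auto
      have "c n = 0" if "n \<in> {Suc N..}" for n
        using N[of "n - 1"] that by (cases n) auto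
      then have "avoids x {Suc N..} x \<omega>"
        unfolding c0 avoids_def by blast
      then show False using A by blast
    qed
  qed
qed

lemma inf_return_prob_eq:
  fixes x :: "'a::countable"
  shows "inf_return_prob P \<mu> x = 1 - finite_visits_prob P \<mu> x x"
proof -
  interpret prob_space "bmc_space P \<mu>" by (rule prob_space_bmc)
  have "{\<omega>. \<exists>n. avoids x {n..} x \<omega>} = (\<Union>n. {\<omega>. avoids x {n..} x \<omega>})" by auto
  then have "{\<omega>. \<exists>n. avoids x {n..} x \<omega>} \<in> events"
    using sets_avoids[of x _ x P \<mu>] by (simp add: sets.countable_UN')
  from prob_compl[OF this] show ?thesis
    unfolding inf_return_prob_def finite_visits_prob_def visits_eq_infinity_iff
    by (simp add: Compl_eq_Diff_UNIV[symmetric] Collect_neg_eq[symmetric])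
qed

lemma avoids_antimono: "S \<subseteq> T \<Longrightarrow> avoids x T y \<omega> \<Longrightarrow> avoids x S y \<omega>"
  unfolding avoids_def by blast

lemma avoid_prob_antimono:
  fixes x :: "'a::countable"
  assumes "S \<subseteq> T"
  shows "avoid_prob P \<mu> x T y \<le> avoid_prob P \<mu> x S y"
proof -
  interpret prob_space "bmc_space P \<mu>" by (rule prob_space_bmc)
  show ?thesis unfolding avoid_prob_def
    by (rule finite_measure_mono) (use avoids_antimono[OF assms] sets_avoids[of x S y P \<mu>] in auto)
qed

lemma avoid_prob_tail_tendsto:
  fixes x :: "'a::countable"
  shows "(\<lambda>n. avoid_prob P \<mu> x {n..} y) \<longlonglongrightarrow> finite_visits_prob P \<mu> x y"
proof -
  interpret prob_space "bmc_space P \<mu>" by (rule prob_space_bmc)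
  have "incseq (\<lambda>n. {\<omega>. avoids x {n..} y \<omega>})"
    by (auto simp: incseq_def intro: avoids_antimono[rotated])
  moreover have "(\<Union>n. {\<omega>. avoids x {n..} y \<omega>}) = {\<omega>. \<exists>n. avoids x {n..} y \<omega>}" by auto
  ultimately show ?thesis
    unfolding avoid_prob_def finite_visits_prob_def
    using finite_Lim_measure_incseq[of "\<lambda>n. {\<omega>. avoids x {n..} y \<omega>}"] sets_avoids[of x _ y P \<mu>]
    by (simp add: image_subset_iff)
qed

lemma avoid_prob_segment_tendsto:
  fixes x :: "'a::countable"
  shows "(\<lambda>n. avoid_prob P \<mu> x {1..n} y) \<longlonglongrightarrow> avoid_prob P \<mu> x {1..} y"
proof -
  interpret prob_space "bmc_space P \<mu>" by (rule prob_space_bmc)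
  have "decseq (\<lambda>n. {\<omega>. avoids x {1..n} y \<omega>})"
    by (auto simp: decseq_def intro: avoids_antimono[rotated])
  moreover have "(\<Inter>n. {\<omega>. avoids x {1..n} y \<omega>}) = {\<omega>. avoids x {1..} y \<omega>}"
  proof -
    have "t \<in> {1..} \<Longrightarrow> t \<in> {1..t}" for t :: nat by simp
    moreover have "{1..n} \<subseteq> {1..}" for n :: nat by auto
    ultimately have "(\<forall>n. \<forall>t\<in>{1..n}. Q t) \<longleftrightarrow> (\<forall>t\<in>{1..}. Q t)" for Q :: "nat \<Rightarrow> bool"
      by blast
    then have "(\<forall>n. avoids x {1..n} y \<omega>) \<longleftrightarrow> avoids x {1..} y \<omega>" for \<omega>
      unfolding avoids_def .
    then show ?thesis by (simp add: set_eq_iff)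
  qed
  ultimately show ?thesis
    unfolding avoid_prob_def
    using finite_Lim_measure_decseq[of "\<lambda>n. {\<omega>. avoids x {1..n} y \<omega>}"] sets_avoids[of x _ y P \<mu>]
    by (simp add: image_subset_iff)
qed

lemma avoid_prob_tail_le:
  fixes x :: "'a::countable"
  shows "avoid_prob P \<mu> x {n..} y \<le> finite_visits_prob P \<mu> x y"
  by (rule incseq_le[OF _ avoid_prob_tail_tendsto]) (auto simp: incseq_def intro!: avoid_prob_antimono)

lemma finite_visits_prob_nonneg [simp]: "0 \<le> finite_visits_prob P \<mu> x y"
  by (simp add: finite_visits_prob_def)

lemma finite_visits_prob_le_1 [simp]: "finite_visits_prob P \<mu> x y \<le> 1"
proof -
  interpret prob_space "bmc_space P \<mu>" by (rule prob_space_bmc)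
  show ?thesis by (simp add: finite_visits_prob_def)
qed

lemma avoid_prob_tail_step:
  fixes x :: "'a::countable"
  shows "avoid_prob P \<mu> x {Suc n..} y = branch P \<mu> (avoid_prob P \<mu> x {n..}) y"
proof -
  have "Suc -` {Suc n..} = {n..}" by auto
  then show ?thesis using avoid_prob_step[of "{Suc n..}" P \<mu> x y] by simp
qed

text \<open>Tails starting at \<open>n\<close> and at \<open>Suc n\<close> have the same limit, so
  the recursion for tails becomes a fixed point equation.\<close>

lemma finite_visits_prob_step:
  fixes x :: "'a::countable"
  shows "finite_visits_prob P \<mu> x y = branch P \<mu> (finite_visits_prob P \<mu> x) y"
proof (rule LIMSEQ_unique)
  show "(\<lambda>n. avoid_prob P \<mu> x {Suc n..} y) \<longlonglongrightarrow> finite_visits_prob P \<mu> x y"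
    by (rule LIMSEQ_Suc[OF avoid_prob_tail_tendsto])
  show "(\<lambda>n. avoid_prob P \<mu> x {Suc n..} y) \<longlonglongrightarrow> branch P \<mu> (finite_visits_prob P \<mu> x) y"
    unfolding avoid_prob_tail_step by (intro branch_tendsto avoid_prob_tail_tendsto) auto
qed

text \<open>After the shift the children's own positions count at time 0; this puts the value 0 at
  \<open>x\<close> and makes the recursion one of first passage type.\<close>

lemma avoid_prob_segment_step:
  fixes x :: "'a::countable"
  shows "avoid_prob P \<mu> x {1..Suc n} y =
    branch P \<mu> (\<lambda>z. if z = x then 0 else avoid_prob P \<mu> x {1..n} z) y"
proof -
  have 1: "Suc -` {1..Suc n} = {0..n}" "{0..n} - {0} = {1..n}" by auto
  have "avoid_prob P \<mu> x {0..n} = (\<lambda>z. if z = x then 0 else avoid_prob P \<mu> x {1..n} z)"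
    using avoid_prob_0[of "{0..n}" P \<mu> x] 1 by auto
  then show ?thesis using avoid_prob_step[of "{1..Suc n}" P \<mu> x y] 1 by simp
qed

lemma avoid_prob_forever_step:
  fixes x :: "'a::countable"
  shows "avoid_prob P \<mu> x {1..} y =
    branch P \<mu> (\<lambda>z. if z = x then 0 else avoid_prob P \<mu> x {1..} z) y"
proof -
  have 1: "Suc -` {1..} = {0..}" "{0..} - {0::nat} = {1..}" by auto
  have "avoid_prob P \<mu> x {0..} = (\<lambda>z. if z = x then 0 else avoid_prob P \<mu> x {1..} z)"
    using avoid_prob_0[of "{0..}" P \<mu> x] 1 by auto
  then show ?thesis using avoid_prob_step[of "{1..}" P \<mu> x y] 1 by simp
qed

section \<open>Spectral radius and first passage\<close>

lemma nstep_add: "nstep P (k + n) x = bind_pmf (nstep P k x) (nstep P n)"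
  by (induction k arbitrary: x) (auto simp: bind_return_pmf bind_assoc_pmf intro!: bind_pmf_cong)

lemma pmf_nstep_mult_le:
  "pmf (nstep P k x) y * pmf (nstep P n y) z \<le> pmf (nstep P (k + n) x) z"
proof -
  have "pmf (nstep P k x) y * pmf (nstep P n y) z =
      measure_pmf.expectation (nstep P k x) (\<lambda>w. indicator {y} w * pmf (nstep P n y) z)"
    by (simp add: pmf.rep_eq)
  also have "\<dots> \<le> measure_pmf.expectation (nstep P k x) (\<lambda>w. pmf (nstep P n w) z)"
    by (intro integral_mono integrable_pmf_bounded[where B = 1])
      (auto simp: indicator_def pmf_le_1)
  also have "\<dots> = pmf (nstep P (k + n) x) z"
    by (simp add: nstep_add pmf_bind)
  finally show ?thesis .
qed

lemma pmf_nstep_mult3_le: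
  "pmf (nstep P a x) y * pmf (nstep P n y) z * pmf (nstep P b z) w \<le> pmf (nstep P (a + n + b) x) w"
  by (rule order_trans[OF mult_right_mono[OF pmf_nstep_mult_le pmf_nonneg] pmf_nstep_mult_le])

lemma limsup_eq_spectral_radius:
  "limsup (\<lambda>n. ereal (root n (pmf (nstep P n x) y))) = ereal (spectral_radius P x y)"
proof -
  let ?L = "limsup (\<lambda>n. ereal (root n (pmf (nstep P n x) y)))"
  \<comment> \<open>At \<open>n = 0\<close> the root is 0 by convention.\<close>
  have "root n (pmf (nstep P n x) y) \<le> 1" for n
    by (cases "n = 0") (auto simp: pmf_le_1)
  then have "?L \<le> 1" by (intro Limsup_bounded) (auto simp: one_ereal_def)
  moreover have "0 \<le> ?L"
    by (rule le_Limsup) (auto simp: zero_ereal_def[symmetric] intro!: always_eventually real_root_ge_zero)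
  ultimately show ?thesis unfolding spectral_radius_def
    by (cases ?L) auto
qed

lemma eventually_pmf_nstep_less_power:
  assumes "spectral_radius P x y < c"
  shows "eventually (\<lambda>n. pmf (nstep P n x) y < c ^ n) sequentially"
proof -
  have "limsup (\<lambda>n. ereal (root n (pmf (nstep P n x) y))) < ereal c"
    using assms by (simp add: limsup_eq_spectral_radius)
  then have "eventually (\<lambda>n. ereal (root n (pmf (nstep P n x) y)) < ereal c) sequentially"
    by (rule Limsup_lessD)
  then show ?thesis using eventually_gt_at_top[of 0]
  proof eventually_elim
    case (elim n)
    have "pmf (nstep P n x) y = root n (pmf (nstep P n x) y) ^ n"
      using elim by simp
    also have "\<dots> < c ^ n"
      using elim by (intro power_strict_mono) auto
    finally show ?case .
  qed
qed

lemma frequently_power_less_pmf_nstep: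
  assumes "c < spectral_radius P x y" "0 \<le> c"
  shows "\<exists>n\<ge>N. c ^ n < pmf (nstep P n x) y"
proof (rule ccontr)
  assume "\<not> ?thesis"
  then have *: "pmf (nstep P n x) y \<le> c ^ n" if "n \<ge> N" for n using that by force
  have "eventually (\<lambda>n. ereal (root n (pmf (nstep P n x) y)) \<le> ereal c) sequentially"
    using eventually_ge_at_top[of "max 1 N"]
  proof eventually_elim
    case (elim n)
    then have "root n (pmf (nstep P n x) y) \<le> root n (c ^ n)"
      using * by (intro real_root_le_mono) auto
    then show ?case using elim assms by (simp add: real_root_power_cancel)
  qed
  then have "limsup (\<lambda>n. ereal (root n (pmf (nstep P n x) y))) \<le> ereal c"
    by (rule Limsup_bounded)
  then show False using assms by (simp add: limsup_eq_spectral_radius)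
qed

lemma irreducible_kernelD:
  assumes "irreducible_kernel P"
  obtains n where "pmf (nstep P n x) y > 0"
  using assms unfolding irreducible_kernel_def by blast

text \<open>Every site is reached from \<open>x\<close> along finitely many transitions of positive
  probability, so a property inherited by successors spreads from \<open>x\<close> to all
  sites.\<close>

lemma irreducible_kernel_induct [consumes 1, case_names base step]:
  assumes "irreducible_kernel P" "R x"
    and step: "\<And>y z. R y \<Longrightarrow> z \<in> set_pmf (P y) \<Longrightarrow> R z"
  shows "R y"
proof -
  obtain n where "pmf (nstep P n x) y > 0" using irreducible_kernelD[OF assms(1)] .
  then have "y \<in> set_pmf (nstep P n x)" by (simp add: set_pmf_iff)
  then show ?thesis using \<open>R x\<close>
    by (induction n arbitrary: x) (auto intro: step)
qed

text \<open>For a pair of equal sites irreducibility may just return time 0. Moving first to a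
  successor \<open>z\<close> and then back makes the time positive.\<close>

lemma irreducible_return:
  assumes "irreducible_kernel P"
  obtains d where "d > 0" "pmf (nstep P d x) x > 0"
proof -
  obtain z where z: "z \<in> set_pmf (P x)" using set_pmf_not_empty[of "P x"] by blast
  obtain n where n: "pmf (nstep P n z) x > 0" using irreducible_kernelD[OF assms] .
  have "pmf (nstep P 1 x) z * pmf (nstep P n z) x \<le> pmf (nstep P (1 + n) x) x"
    by (rule pmf_nstep_mult_le)
  moreover have "pmf (nstep P 1 x) z > 0"
    using z by (simp add: bind_return_pmf' pmf_positive_iff)
  ultimately have "pmf (nstep P (1 + n) x) x > 0"
    using n by (smt (verit) mult_pos_pos)
  then show thesis by (intro that[of "1 + n"]) auto
qed

text \<open>Repeating a loop at \<open>x\<close> and then going to \<open>y\<close> has probability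
  at least \<delta>^(k+1) at time k d + b. This decays too slowly for a spectral radius below
  \<delta>^2.\<close>

lemma spectral_radius_pos:
  assumes "irreducible_kernel P"
  shows "0 < spectral_radius P x y"
proof -
  obtain d where d: "d > 0" "pmf (nstep P d x) x > 0" using irreducible_return[OF assms] .
  obtain b where b: "pmf (nstep P b x) y > 0" using irreducible_kernelD[OF assms] .
  define \<delta> where "\<delta> = min (pmf (nstep P d x) x) (pmf (nstep P b x) y)"
  have \<delta>: "0 < \<delta>" "\<delta> \<le> 1" using d b by (auto simp: \<delta>_def pmf_le_1 min_le_iff_disj)
  have lower: "\<delta> ^ Suc k \<le> pmf (nstep P (k * d + b) x) y" for k
  proof (induction k)
    case (Suc k)
    have "\<delta> ^ Suc (Suc k) \<le> pmf (nstep P d x) x * pmf (nstep P (k * d + b) x) y"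
      using mult_mono[OF _ Suc.IH, of \<delta> "pmf (nstep P d x) x"] \<delta> by (simp add: \<delta>_def)
    also have "\<dots> \<le> pmf (nstep P (d + (k * d + b)) x) y" by (rule pmf_nstep_mult_le)
    finally show ?case by (simp add: add.assoc)
  qed (simp add: \<delta>_def)
  have "\<not> spectral_radius P x y < \<delta>\<^sup>2"
  proof
    assume "spectral_radius P x y < \<delta>\<^sup>2"
    from eventually_pmf_nstep_less_power[OF this] obtain N
      where N: "pmf (nstep P n x) y < (\<delta>\<^sup>2) ^ n" if "n \<ge> N" for n
      unfolding eventually_sequentially by auto
    \<comment> \<open>Any k \<ge> 1 gives k + 1 \<le> 2 (k d + b), and k \<ge> N makes the time
      large enough for the upper bound.\<close>
    define k where "k = Suc N"
    have kd: "k \<le> k * d + b" using d by (simp add: trans_le_add1)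
    have "(\<delta>\<^sup>2) ^ (k * d + b) \<le> \<delta> ^ Suc k"
      unfolding power_mult[symmetric]
      using kd \<delta> by (intro power_decreasing) (auto simp: k_def)
    also have "\<dots> \<le> pmf (nstep P (k * d + b) x) y" by (rule lower)
    also have "\<dots> < (\<delta>\<^sup>2) ^ (k * d + b)" by (rule N) (use kd in \<open>simp add: k_def\<close>)
    finally show False by simp
  qed
  then show ?thesis using \<delta> by (smt (verit) zero_less_power)
qed

text \<open>Choose \<open>c\<close> between \<open>1 / m\<close> and the spectral radius. Passing
  from the given pair of sites to a return to \<open>x\<close> costs the fixed factor
  \<open>K\<close>, which the growth of (m c)^n outweighs.\<close>

lemma exists_supercritical_return:
  assumes "irreducible_kernel P" "1 < m" "1 / m < spectral_radius P x\<^sub>0 y\<^sub>0"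
  obtains N where "1 < m ^ N * pmf (nstep P N x) x"
proof -
  obtain c where c: "1 / m < c" "c < spectral_radius P x\<^sub>0 y\<^sub>0"
    using dense[OF assms(3)] by blast
  have c0: "0 < c" using c(1) assms(2) by (smt (verit) divide_nonneg_nonneg)
  obtain a where a: "pmf (nstep P a x) x\<^sub>0 > 0" using irreducible_kernelD[OF assms(1)] .
  obtain b where b: "pmf (nstep P b y\<^sub>0) x > 0" using irreducible_kernelD[OF assms(1)] .
  define K where "K = pmf (nstep P a x) x\<^sub>0 * pmf (nstep P b y\<^sub>0) x"
  have K: "K > 0" using a b by (simp add: K_def)
  have "1 < m * c" using c(1) assms(2) by (simp add: divide_less_eq mult.commute)
  then obtain n\<^sub>0 where n\<^sub>0: "1 / K < (m * c) ^ n\<^sub>0" using real_arch_pow by blast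
  obtain n where n: "n \<ge> n\<^sub>0" "c ^ n < pmf (nstep P n x\<^sub>0) y\<^sub>0"
    using frequently_power_less_pmf_nstep[OF c(2)] c0 by (metis less_imp_le)
  have "1 / K < (m * c) ^ n"
    using n\<^sub>0 power_increasing[OF n(1), of "m * c"] \<open>1 < m * c\<close> by linarith
  then have "1 < m ^ n * (c ^ n * K)"
    using K by (simp add: power_mult_distrib divide_less_eq mult.assoc)
  also have "\<dots> \<le> m ^ (a + n + b) * (c ^ n * K)"
    using assms(2) K c0 by (intro mult_right_mono power_increasing) auto
  also have "c ^ n * K \<le> pmf (nstep P a x) x\<^sub>0 * pmf (nstep P n x\<^sub>0) y\<^sub>0 * pmf (nstep P b y\<^sub>0) x"
    using mult_right_mono[OF less_imp_le[OF n(2)], of K] K by (simp add: K_def mult_ac)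
  also have "\<dots> \<le> pmf (nstep P (a + n + b) x) x" by (rule pmf_nstep_mult3_le)
  finally have "1 < m ^ (a + n + b) * pmf (nstep P (a + n + b) x) x"
    using assms(2) by (simp add: mult_left_mono)
  then show thesis by (rule that)
qed

text \<open>The same connecting paths, used in the other direction, bound returns to
  \<open>x\<close> by a constant times c^n for some \<open>c\<close> with z c < 1.\<close>

lemma summable_green:
  assumes "irreducible_kernel P" "0 < z" "z * spectral_radius P x\<^sub>0 y\<^sub>0 < 1"
  shows "summable (\<lambda>n. z ^ n * pmf (nstep P n x) x)"
proof -
  obtain a where a: "pmf (nstep P a x\<^sub>0) x > 0" using irreducible_kernelD[OF assms(1)] .
  obtain b where b: "pmf (nstep P b x) y\<^sub>0 > 0" using irreducible_kernelD[OF assms(1)] .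
  define K where "K = pmf (nstep P a x\<^sub>0) x * pmf (nstep P b x) y\<^sub>0"
  have K: "K > 0" using a b by (simp add: K_def)
  have "spectral_radius P x\<^sub>0 y\<^sub>0 < 1 / z" using assms by (simp add: less_divide_eq mult.commute)
  then obtain c where c: "spectral_radius P x\<^sub>0 y\<^sub>0 < c" "c < 1 / z" using dense by blast
  have c0: "0 < c" using c spectral_radius_pos[OF assms(1), of x\<^sub>0 y\<^sub>0] by linarith
  obtain N where N: "pmf (nstep P n x\<^sub>0) y\<^sub>0 < c ^ n" if "n \<ge> N" for n
    using eventually_pmf_nstep_less_power[OF c(1)] unfolding eventually_sequentially by auto
  have bound: "norm (z ^ n * pmf (nstep P n x) x) \<le> c ^ (a + b) / K * (z * c) ^ n" if "n \<ge> N" for n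
  proof -
    have "pmf (nstep P n x) x * K \<le> pmf (nstep P (a + n + b) x\<^sub>0) y\<^sub>0"
      using pmf_nstep_mult3_le[of P a x\<^sub>0 x n x b y\<^sub>0] by (simp add: K_def mult_ac)
    also have "\<dots> \<le> c ^ (a + n + b)" using N[of "a + n + b"] that by simp
    finally have "pmf (nstep P n x) x \<le> c ^ (a + n + b) / K" using K by (simp add: le_divide_eq)
    then have "z ^ n * pmf (nstep P n x) x \<le> z ^ n * (c ^ (a + n + b) / K)"
      using assms(2) by (intro mult_left_mono) auto
    then show ?thesis using assms(2) by (simp add: power_add power_mult_distrib mult_ac)
  qed
  show ?thesis
  proof (rule summable_comparison_test)
    show "summable (\<lambda>n. c ^ (a + b) / K * (z * c) ^ n)"
      using c c0 assms(2) by (intro summable_mult summable_geometric) (simp add: field_simps)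
  qed (use bound in \<open>intro exI allI impI\<close>)
qed

section \<open>Green function and first passage generating function\<close>

definition green :: "('a \<Rightarrow> 'a pmf) \<Rightarrow> ennreal \<Rightarrow> 'a \<Rightarrow> 'a \<Rightarrow> ennreal" where
  "green P z x y = (\<Sum>n. z ^ n * ennreal (pmf (nstep P n y) x))"

text \<open>The sum of \<open>z\<^sup>k f\<^sup>k(y, x)\<close> over \<open>1 \<le> k \<le> n\<close>, where \<open>f\<^sup>k(y, x)\<close> is the probability that the
  chain started at \<open>y\<close> visits \<open>x\<close> at time \<open>k\<close> for the first time after time 0.\<close>

primrec first_passage :: "('a \<Rightarrow> 'a pmf) \<Rightarrow> ennreal \<Rightarrow> 'a \<Rightarrow> nat \<Rightarrow> 'a \<Rightarrow> ennreal" where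
  "first_passage P z x 0 y = 0"
| "first_passage P z x (Suc n) y =
     z * (\<integral>\<^sup>+w. (if w = x then 1 else first_passage P z x n w) \<partial>P y)"

lemma green_step:
  "green P z x y = (if y = x then 1 else 0) + z * (\<integral>\<^sup>+w. green P z x w \<partial>P y)"
proof -
  let ?f = "\<lambda>n y. z ^ n * ennreal (pmf (nstep P n y) x)"
  have "green P z x y = (\<Sum>n. ?f (Suc n) y) + ?f 0 y"
    unfolding green_def using sums_Suc[OF summable_sums[OF summableI], of "\<lambda>n. ?f n y"]
    by (simp add: sums_iff)
  also have "?f 0 y = (if y = x then 1 else 0)" by auto
  also have "?f (Suc n) y = z * (\<integral>\<^sup>+w. ?f n w \<partial>P y)" for n
    by (simp add: ennreal_pmf_bind nn_integral_cmult mult.assoc)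
  then have "(\<Sum>n. ?f (Suc n) y) = (\<Sum>n. z * (\<integral>\<^sup>+w. ?f n w \<partial>P y))" by simp
  also have "\<dots> = z * (\<integral>\<^sup>+w. green P z x w \<partial>P y)"
    unfolding green_def by (simp add: nn_integral_suminf ennreal_suminf_cmult)
  finally show ?thesis by (simp add: add.commute)
qed

text \<open>A truncated form of the renewal identity F(y, x | z) G(x, x | z) = G(y, x | z) for y
  different from x, where G(y, x | z) is \<open>green P z x y\<close>. Leaving out the time 0 term
  on the right covers y = x as well.\<close>

lemma first_passage_mult_green_le:
  "first_passage P z x n y * green P z x x \<le> z * (\<integral>\<^sup>+w. green P z x w \<partial>P y)"
proof (induction n arbitrary: y)
  case (Suc n)
  have "first_passage P z x (Suc n) y * green P z x x =
      z * (\<integral>\<^sup>+w. (if w = x then 1 else first_passage P z x n w) * green P z x x \<partial>P y)"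
    by (simp add: nn_integral_multc mult.assoc)
  also have "\<dots> \<le> z * (\<integral>\<^sup>+w. green P z x w \<partial>P y)"
  proof (intro mult_left_mono nn_integral_mono)
    fix w
    show "(if w = x then 1 else first_passage P z x n w) * green P z x x \<le> green P z x w"
    proof (cases "w = x")
      case False
      then have "green P z x w = z * (\<integral>\<^sup>+v. green P z x v \<partial>P w)"
        using green_step[of P z x w] by simp
      then show ?thesis using Suc.IH[of w] False by simp
    qed simp
  qed simp
  finally show ?case .
qed simp

text \<open>The renewal bound gives F G \<le> G at \<open>x\<close>, and G can be cancelled because
  it is finite and at least 1.\<close>

lemma first_passage_le_1_of_green:
  assumes "green P z x x \<noteq> \<infinity>"
  shows "first_passage P z x n x \<le> 1"
proof -
  let ?g = "green P z x x"
  have g: "?g = 1 + z * (\<integral>\<^sup>+w. green P z x w \<partial>P x)" using green_step[of P z x x] by simp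
  then have "?g \<noteq> 0" by (metis add_eq_0_iff_both_eq_0 zero_neq_one)
  moreover have "?g * first_passage P z x n x \<le> ?g * 1"
  proof -
    have "z * (\<integral>\<^sup>+w. green P z x w \<partial>P x) \<le> ?g"
      unfolding g by (rule add_increasing) auto
    with first_passage_mult_green_le[of P z x n x] show ?thesis
      by (simp add: mult.commute)
  qed
  ultimately show ?thesis
    using assms ennreal_mult_le_mult_iff[of ?g "first_passage P z x n x" 1] by simp
qed

text \<open>\<open>first_passage\<close> at stage \<open>n\<close> only has powers of
  \<open>z\<close> of degree at most \<open>n\<close>, so scaling \<open>z\<close> by
  \<open>r\<close> costs at most a factor r^n.\<close>

lemma first_passage_scale:
  assumes "r \<le> 1"
  shows "r ^ n * first_passage P z x n y \<le> first_passage P (r * z) x n y"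
proof (induction n arbitrary: y)
  case (Suc n)
  have "r ^ Suc n * first_passage P z x (Suc n) y =
      (r * z) * (\<integral>\<^sup>+w. r ^ n * (if w = x then 1 else first_passage P z x n w) \<partial>P y)"
    by (simp add: nn_integral_cmult mult_ac)
  also have "\<dots> \<le> (r * z) * (\<integral>\<^sup>+w. (if w = x then 1 else first_passage P (r * z) x n w) \<partial>P y)"
    by (intro mult_left_mono nn_integral_mono) (use Suc.IH assms in \<open>auto simp: power_le_one\<close>)
  finally show ?case by simp
qed simp

text \<open>The renewal identity only controls \<open>z < 1 / \<rho>\<close>; the bound extends to \<open>z = 1 / \<rho>\<close> because
  \<open>first_passage\<close> is left continuous in \<open>z\<close>.\<close>

lemma first_passage_le_1:
  assumes "irreducible_kernel P" "0 < z" "z * spectral_radius P x\<^sub>0 y\<^sub>0 \<le> 1"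
  shows "first_passage P (ennreal z) x n x \<le> 1"
proof -
  let ?F = "first_passage P (ennreal z) x n x"
  \<comment> \<open>The double successor keeps \<open>r 0\<close> positive; the sequence increases
    to 1.\<close>
  define r where "r k = 1 - inverse (real (Suc (Suc k)))" for k
  have r: "0 < r k" "r k < 1" for k by (auto simp: r_def field_simps)
  have *: "ennreal (r k ^ n) * ?F \<le> 1" for k
  proof -
    have "r k * (z * spectral_radius P x\<^sub>0 y\<^sub>0) < 1"
      using mult_left_le[OF assms(3) less_imp_le[OF r(1)[of k]]] r(2)[of k] by linarith
    then have "summable (\<lambda>n. (r k * z) ^ n * pmf (nstep P n x) x)"
      using r[of k] assms by (intro summable_green[OF assms(1), of _ x\<^sub>0 y\<^sub>0]) (auto simp: mult.assoc)
    then have "(\<Sum>n. ennreal ((r k * z) ^ n * pmf (nstep P n x) x)) \<noteq> \<infinity>"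
      using r[of k] assms unfolding infinity_ennreal_def by (intro ennreal_suminf_neq_top) auto
    moreover have "ennreal ((r k * z) ^ n * pmf (nstep P n x) x) =
        ennreal (r k * z) ^ n * ennreal (pmf (nstep P n x) x)" for n
      using r[of k] assms by (subst ennreal_mult) (auto simp: ennreal_power)
    ultimately have "green P (ennreal (r k * z)) x x \<noteq> \<infinity>"
      unfolding green_def by simp
    then have "first_passage P (ennreal (r k) * ennreal z) x n x \<le> 1"
      using first_passage_le_1_of_green[of P "ennreal (r k * z)" x n] r[of k] assms
      by (simp add: ennreal_mult)
    moreover have "ennreal (r k) ^ n * ?F \<le> first_passage P (ennreal (r k) * ennreal z) x n x"
      by (rule first_passage_scale) (use r[of k] in simp)
    ultimately show ?thesis using r[of k] by (metis ennreal_power less_imp_le order_trans)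
  qed
  have "(\<lambda>k. r k ^ n) \<longlonglongrightarrow> (1 - 0) ^ n"
    unfolding r_def by (intro tendsto_power tendsto_diff tendsto_const LIMSEQ_Suc[OF LIMSEQ_inverse_real_of_nat])
  then have "(\<lambda>k. ennreal (r k ^ n) * ?F) \<longlonglongrightarrow> ennreal 1 * ?F"
    by (intro tendsto_mult_ennreal tendsto_const tendsto_ennrealI) auto
  then have "ennreal 1 * ?F \<le> 1"
    by (rule LIMSEQ_le_const2) (use * in blast)
  then show ?thesis by simp
qed

section \<open>Transience\<close>

lemma first_passage_incseq: "incseq (\<lambda>n. first_passage P z x n y)"
proof (rule incseq_SucI)
  fix n
  show "first_passage P z x n y \<le> first_passage P z x (Suc n) y"
  proof (induction n arbitrary: y)
    case (Suc n)
    show ?case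
      unfolding first_passage.simps(2)[of P z x n] first_passage.simps(2)[of P z x "Suc n"]
      by (intro mult_left_mono nn_integral_mono) (use Suc.IH in auto)
  qed simp
qed

definition first_passage_total :: "('a \<Rightarrow> 'a pmf) \<Rightarrow> ennreal \<Rightarrow> 'a \<Rightarrow> 'a \<Rightarrow> ennreal" where
  "first_passage_total P z x y = (SUP n. first_passage P z x n y)"

lemma first_passage_tendsto:
  "(\<lambda>n. first_passage P z x n y) \<longlonglongrightarrow> first_passage_total P z x y"
  unfolding first_passage_total_def by (rule LIMSEQ_SUP[OF first_passage_incseq])

lemma first_passage_total_step:
  "first_passage_total P z x y =
    z * (\<integral>\<^sup>+w. (if w = x then 1 else first_passage_total P z x w) \<partial>P y)"
proof (rule LIMSEQ_unique)
  show "(\<lambda>n. first_passage P z x (Suc n) y) \<longlonglongrightarrow> first_passage_total P z x y"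
    by (rule LIMSEQ_Suc[OF first_passage_tendsto])
  let ?f = "\<lambda>n w. if w = x then 1 else first_passage P z x n w"
  have inc: "incseq (\<lambda>n. ?f n w)" for w
    using first_passage_incseq[of P z x w] by (auto simp: incseq_def)
  have "(SUP n. ?f n w) = (if w = x then 1 else first_passage_total P z x w)" for w
    by (simp add: first_passage_total_def)
  then have "(\<integral>\<^sup>+w. (if w = x then 1 else first_passage_total P z x w) \<partial>P y) =
      (\<integral>\<^sup>+w. (SUP n. ?f n w) \<partial>P y)" by simp
  also have "\<dots> = (SUP n. \<integral>\<^sup>+w. ?f n w \<partial>P y)"
    by (rule nn_integral_monotone_convergence_SUP) (use inc in \<open>auto simp: incseq_def le_fun_def\<close>)
  finally have "z * (\<integral>\<^sup>+w. (if w = x then 1 else first_passage_total P z x w) \<partial>P y) =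
      (SUP n. first_passage P z x (Suc n) y)"
    by (simp add: SUP_mult_left_ennreal)
  moreover have "incseq (\<lambda>n. first_passage P z x (Suc n) y)"
    using first_passage_incseq[of P z x y] unfolding incseq_def by (meson Suc_le_mono)
  ultimately show "(\<lambda>n. first_passage P z x (Suc n) y) \<longlonglongrightarrow>
      z * (\<integral>\<^sup>+w. (if w = x then 1 else first_passage_total P z x w) \<partial>P y)"
    using LIMSEQ_SUP by metis
qed

locale branching_chain =
  fixes P :: "'a::countable \<Rightarrow> 'a pmf" and \<mu> :: "'a \<Rightarrow> nat pmf" and m :: real
  assumes irreducible: "irreducible_kernel P"
    and no_death: "\<And>x. pmf (\<mu> x) 0 = 0"
    and mean_offspring: "\<And>x. (\<lambda>k. real k * pmf (\<mu> x) k) sums m"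
    and m_gt_1: "1 < m"
begin

lemmas integrable_offspring = expectation_of_nat_pmf(1)[OF mean_offspring]
lemmas expectation_offspring = expectation_of_nat_pmf(2)[OF mean_offspring]

abbreviation "mean_op q y \<equiv> measure_pmf.expectation (P y) q"

lemma one_minus_branch:
  assumes "\<And>z. 0 \<le> q z" "\<And>z. q z \<le> 1"
  shows "1 - branch P \<mu> q y = mean_op (\<lambda>z. 1 - q z) y * gf_slope (\<mu> y) (mean_op q y)"
  using one_minus_offspring_gf[of "mean_op q y" "\<mu> y"] expectation_unit_interval[of q "P y"] assms
  by (simp add: branch_def)

lemma one_minus_branch_le:
  assumes "\<And>z. 0 \<le> q z" "\<And>z. q z \<le> 1"
  shows "1 - branch P \<mu> q y \<le> m * mean_op (\<lambda>z. 1 - q z) y"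
proof -
  have "gf_slope (\<mu> y) (mean_op q y) \<le> m"
    using gf_slope_le_mean[OF integrable_offspring] expectation_unit_interval[of q "P y"] assms
    by (simp add: expectation_offspring)
  then show ?thesis
    unfolding one_minus_branch[of q y, OF assms]
    using mult_left_mono[of _ m "mean_op (\<lambda>z. 1 - q z) y"] assms by (simp add: mult.commute)
qed

text \<open>A value below 1 excludes that \<open>q\<close> is 1 at almost every successor of
  \<open>y\<close>, so the chord slope is taken strictly left of 1. This strictness decides the
  critical case.\<close>

lemma one_minus_branch_less:
  assumes "\<And>z. 0 \<le> q z" "\<And>z. q z \<le> 1" "branch P \<mu> q y < 1"
  shows "1 - branch P \<mu> q y < m * mean_op (\<lambda>z. 1 - q z) y"
proof -
  note q = expectation_unit_interval[of q "P y", OF assms(1,2)]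
  have "mean_op q y \<noteq> 1" using assms(3) by (auto simp: branch_def)
  then have lt: "mean_op q y < 1" using q by simp
  have "gf_slope (\<mu> y) (mean_op q y) < m"
    using gf_slope_less_mean[OF integrable_offspring _ q(1) lt] m_gt_1
    by (simp add: expectation_offspring)
  moreover have "mean_op (\<lambda>z. 1 - q z) y > 0" using lt q by simp
  ultimately show ?thesis
    unfolding one_minus_branch[of q y, OF assms(1,2)]
    by (simp add: mult.commute)
qed

lemma ennreal_mean_op:
  assumes "\<And>z. 0 \<le> q z" "\<And>z. q z \<le> 1"
  shows "ennreal (m * mean_op q y) = ennreal m * (\<integral>\<^sup>+z. ennreal (q z) \<partial>P y)"
  using m_gt_1 assms expectation_unit_interval[of q "P y"]
  by (simp add: ennreal_mult nn_integral_eq_integral)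

lemma ennreal_one_minus_branch_le:
  assumes "\<And>z. 0 \<le> q z" "\<And>z. q z \<le> 1"
  shows "ennreal (1 - branch P \<mu> q y) \<le> ennreal m * (\<integral>\<^sup>+z. ennreal (1 - q z) \<partial>P y)"
  using ennreal_leI[OF one_minus_branch_le[of q y]] ennreal_mean_op[of "\<lambda>z. 1 - q z" y] assms
  by simp

text \<open>\<open>first_passage\<close> at \<open>m\<close> is the expected number of particles
  that are the first after the root in their line of descent to visit \<open>x\<close>. It bounds
  the probability that there is one; the proof compares the two recursions.\<close>

lemma hit_prob_le_first_passage:
  "ennreal (1 - avoid_prob P \<mu> x {1..n} y) \<le> first_passage P (ennreal m) x n y"
proof (induction n arbitrary: y)
  case 0
  interpret prob_space "bmc_space P \<mu>" by (rule prob_space_bmc)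
  show ?case using prob_space by (simp add: avoid_prob_def avoids_def)
next
  case (Suc n)
  let ?q = "\<lambda>z. if z = x then 0 else avoid_prob P \<mu> x {1..n} z"
  have "ennreal (1 - avoid_prob P \<mu> x {1..Suc n} y) \<le> ennreal m * (\<integral>\<^sup>+z. ennreal (1 - ?q z) \<partial>P y)"
    unfolding avoid_prob_segment_step by (rule ennreal_one_minus_branch_le) auto
  also have "\<dots> \<le> first_passage P (ennreal m) x (Suc n) y"
    unfolding first_passage.simps
    by (intro mult_left_mono nn_integral_mono) (use Suc.IH in auto)
  finally show ?case .
qed

lemma infinite_visits_prob_le_first_passage:
  "ennreal (1 - finite_visits_prob P \<mu> x y) \<le> first_passage_total P (ennreal m) x y"
proof -
  have bound: "ennreal (1 - avoid_prob P \<mu> x {1..n} y) \<le> first_passage_total P (ennreal m) x y" for n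
    using hit_prob_le_first_passage[of x n y]
    unfolding first_passage_total_def by (rule order_trans) (auto intro: SUP_upper)
  have "(\<lambda>n. ennreal (1 - avoid_prob P \<mu> x {1..n} y)) \<longlonglongrightarrow>
      ennreal (1 - avoid_prob P \<mu> x {1..} y)"
    by (intro tendsto_ennrealI tendsto_diff tendsto_const avoid_prob_segment_tendsto)
  then have "ennreal (1 - avoid_prob P \<mu> x {1..} y) \<le> first_passage_total P (ennreal m) x y"
    by (rule LIMSEQ_le_const2) (use bound in blast)
  moreover have "ennreal (1 - finite_visits_prob P \<mu> x y) \<le> ennreal (1 - avoid_prob P \<mu> x {1..} y)"
    by (intro ennreal_leI) (simp add: avoid_prob_tail_le)
  ultimately show ?thesis by (rule order_trans[rotated])
qed

text \<open>Up to an error controlled by the tail of the first passage generating function, infinitely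
  many visits to \<open>x\<close> start with a first visit to \<open>x\<close>. The tail is moved to the other side because
  it may be infinite.\<close>

lemma infinite_visits_prob_first_passage:
  fixes x :: 'a and F h
  defines "F \<equiv> first_passage P (ennreal m) x"
    and "h \<equiv> \<lambda>y. ennreal (1 - finite_visits_prob P \<mu> x y)"
  shows "ennreal m * (\<integral>\<^sup>+z. h z \<partial>P y) + F (Suc n) y \<le>
      F (Suc n) y * h x + first_passage_total P (ennreal m) x y"
proof -
  let ?T = "first_passage_total P (ennreal m) x"
  \<comment> \<open>The induction step without its last estimate h \<le> m P h: the lemma is about m
    P h itself, and the gap to h is exploited only afterwards.\<close>
  have step: "ennreal m * (\<integral>\<^sup>+z. h z \<partial>P y) + F (Suc n) y \<le> F (Suc n) y * h x + ?T y"
    if IH: "\<And>y. h y + F n y \<le> F n y * h x + ?T y" for n y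
  proof -
    have "ennreal m * (\<integral>\<^sup>+z. h z \<partial>P y) + F (Suc n) y =
        ennreal m * (\<integral>\<^sup>+z. h z + (if z = x then 1 else F n z) \<partial>P y)"
      unfolding F_def by (simp add: nn_integral_add distrib_left)
    \<comment> \<open>At z = x both integrands equal \<open>h x + 1\<close>; elsewhere the induction
      hypothesis applies.\<close>
    also have "\<dots> \<le> ennreal m *
        (\<integral>\<^sup>+z. (if z = x then 1 else F n z) * h x + (if z = x then 1 else ?T z) \<partial>P y)"
      by (intro mult_left_mono nn_integral_mono) (use IH in auto)
    also have "\<dots> = F (Suc n) y * h x + ?T y"
      unfolding F_def by (subst (2) first_passage_total_step)
        (simp add: nn_integral_add nn_integral_multc distrib_left mult.assoc)
    finally show ?thesis .
  qed
  have main: "h y + F n y \<le> F n y * h x + ?T y" for n y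
  proof (induction n arbitrary: y)
    \<comment> \<open>Since \<open>F 0\<close> vanishes, the claim is that infinitely many visits
      require a first one at a positive time.\<close>
    case 0
    show ?case using infinite_visits_prob_le_first_passage[of x y] by (simp add: F_def h_def)
  next
    case (Suc n)
    have "h y \<le> ennreal m * (\<integral>\<^sup>+z. h z \<partial>P y)"
      unfolding h_def
      using ennreal_one_minus_branch_le[of "finite_visits_prob P \<mu> x" y]
      by (simp flip: finite_visits_prob_step)
    then show ?case using step[OF Suc.IH, of y] by (meson add_right_mono order_trans)
  qed
  show ?thesis by (rule step) (rule main)
qed

lemma finite_visits_almost_surely:
  assumes "m * spectral_radius P x\<^sub>0 y\<^sub>0 \<le> 1"
  shows "finite_visits_prob P \<mu> x x = 1"
proof (rule ccontr)
  assume "finite_visits_prob P \<mu> x x \<noteq> 1"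
  then have lt: "finite_visits_prob P \<mu> x x < 1"
    using finite_visits_prob_le_1[of P \<mu> x x] by linarith
  let ?g = "finite_visits_prob P \<mu> x"
  let ?F = "\<lambda>n. first_passage P (ennreal m) x n x"
  let ?T = "first_passage_total P (ennreal m) x x"
  define I where "I = ennreal m * (\<integral>\<^sup>+z. ennreal (1 - ?g z) \<partial>P x)"
  have F1: "?F n \<le> 1" for n
    using first_passage_le_1[OF irreducible _ assms] m_gt_1 by simp
  then have T1: "?T \<le> 1" unfolding first_passage_total_def by (auto intro: SUP_least)
  have bound: "I + ?F (Suc n) \<le> ennreal (1 - ?g x) + ?T" for n
  proof -
    have "I + ?F (Suc n) \<le> ?F (Suc n) * ennreal (1 - ?g x) + ?T"
      unfolding I_def by (rule infinite_visits_prob_first_passage)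
    also have "\<dots> \<le> 1 * ennreal (1 - ?g x) + ?T"
      by (intro add_right_mono mult_right_mono F1) auto
    finally show ?thesis by simp
  qed
  have "(\<lambda>n. I + ?F (Suc n)) \<longlonglongrightarrow> I + ?T"
    by (intro tendsto_add tendsto_const LIMSEQ_Suc[OF first_passage_tendsto])
  then have "I + ?T \<le> ennreal (1 - ?g x) + ?T"
    by (rule LIMSEQ_le_const2) (use bound in blast)
  \<comment> \<open>The bound by 1 makes the first passage total finite, so it may be
    cancelled.\<close>
  moreover have "?T \<noteq> \<top>" using T1 by (auto simp: top_unique)
  ultimately have "I \<le> ennreal (1 - ?g x)"
    using ennreal_add_left_cancel_le[of ?T I "ennreal (1 - ?g x)"] by (simp add: add.commute)
  moreover have "I = ennreal (m * mean_op (\<lambda>z. 1 - ?g z) x)"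
    unfolding I_def by (rule ennreal_mean_op[symmetric]) auto
  moreover have "1 - ?g x < m * mean_op (\<lambda>z. 1 - ?g z) x"
    using one_minus_branch_less[of ?g x] lt by (simp flip: finite_visits_prob_step)
  ultimately show False using lt by (simp add: ennreal_le_iff)
qed

end

section \<open>Recurrence\<close>

context branching_chain
begin

abbreviation "branch_n n \<equiv> (branch P \<mu> ^^ n)"

lemma branch_n_unit_interval:
  assumes "\<And>z. 0 \<le> q z" "\<And>z. q z \<le> 1"
  shows "0 \<le> branch_n n q y" "branch_n n q y \<le> 1"
  by (induction n arbitrary: y) (auto simp: assms intro: branch_unit_interval)

lemma branch_n_mono:
  assumes "\<And>z. 0 \<le> q z" "\<And>z. q z \<le> r z" "\<And>z. r z \<le> 1"
  shows "branch_n n q y \<le> branch_n n r y"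
proof (induction n arbitrary: y)
  case (Suc n)
  have "0 \<le> r z" "q z \<le> 1" for z using assms order_trans by blast+
  then show ?case
    using assms by (auto intro!: branch_mono Suc.IH branch_n_unit_interval)
qed (simp add: assms)

lemma avoid_prob_single:
  "avoid_prob P \<mu> x {n} y = branch_n n (\<lambda>z. 1 - indicator {x} z) y"
proof (induction n arbitrary: y)
  case 0
  interpret prob_space "bmc_space P \<mu>" by (rule prob_space_bmc)
  have "avoid_prob P \<mu> x {} y = 1" using prob_space by (simp add: avoid_prob_def avoids_def)
  then show ?case using avoid_prob_0[of "{0}" P \<mu> x y] by simp
next
  case (Suc n)
  have "Suc -` {Suc n} = {n}" by auto
  moreover have "avoid_prob P \<mu> x {n} = branch_n n (\<lambda>z. 1 - indicator {x} z)"
    using Suc.IH by auto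
  ultimately show ?case using avoid_prob_step[of "{Suc n}" P \<mu> x y] by simp
qed

section \<open>Linearisation of the branching operator at 1\<close>

lemma one_minus_branch_n_le:
  assumes "0 \<le> s" "s \<le> 1"
  shows "1 - branch_n n (\<lambda>z. 1 - s * indicator {x} z) y \<le> m ^ n * s"
proof (induction n arbitrary: y)
  case 0
  show ?case using assms by (simp add: indicator_def)
next
  case (Suc n)
  let ?q = "branch_n n (\<lambda>z. 1 - s * indicator {x} z)"
  have q: "0 \<le> ?q z" "?q z \<le> 1" for z
    by (rule branch_n_unit_interval; use assms in \<open>simp add: indicator_def\<close>)+
  have "1 - branch P \<mu> ?q y \<le> m * mean_op (\<lambda>z. 1 - ?q z) y"
    by (rule one_minus_branch_le) (rule q)+
  also have "mean_op (\<lambda>z. 1 - ?q z) y \<le> mean_op (\<lambda>_. m ^ n * s) y"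
    by (rule integral_mono[OF expectation_unit_interval(3)]) (use q Suc.IH in auto)
  finally show ?case using m_gt_1 by (simp add: mult.assoc)
qed

text \<open>This is the derivative of \<open>branch_n n\<close> at the constant 1 in the direction
  of the indicator of \<open>x\<close>. As in a chain rule, each application of
  \<open>branch\<close> averages the difference quotients and multiplies them by a chord slope
  tending to \<open>m\<close>.\<close>

lemma branch_n_linearisation:
  assumes S: "S \<longlonglongrightarrow> 0" "\<And>j. 0 < S j" "\<And>j. S j \<le> 1"
  shows "(\<lambda>j. (1 - branch_n n (\<lambda>z. 1 - S j * indicator {x} z) y) / S j)
    \<longlonglongrightarrow> m ^ n * pmf (nstep P n y) x"
proof (induction n arbitrary: y)
  case 0
  have "(1 - branch_n 0 (\<lambda>z. 1 - S j * indicator {x} z) y) / S j = pmf (nstep P 0 y) x" for j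
    using S(2)[of j] by (simp add: indicator_def)
  then show ?case by simp
next
  case (Suc n)
  let ?q = "\<lambda>j. branch_n n (\<lambda>z. 1 - S j * indicator {x} z)"
  define d where "d j = mean_op (\<lambda>z. (1 - ?q j z) / S j) y" for j
  have q: "0 \<le> ?q j z" "?q j z \<le> 1" for j z
    by (rule branch_n_unit_interval; use S(2,3)[of j] in \<open>simp add: indicator_def\<close>)+
  note iq = expectation_unit_interval[of "?q j" "P y" for j, OF q]
  have dq: "mean_op (\<lambda>z. 1 - ?q j z) y = S j * d j" for j
    using S(2)[of j] by (simp add: d_def)
  have "d \<longlonglongrightarrow> mean_op (\<lambda>z. m ^ n * pmf (nstep P n z) x) y"
    unfolding d_def
  proof (rule integral_dominated_convergence[where w = "\<lambda>_. m ^ n"])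
    \<comment> \<open>The bound of \<open>one_minus_branch_n_le\<close> is uniform in the site and
      linear in \<open>S j\<close>, so a constant dominates the quotients.\<close>
    show "AE z in P y. norm ((1 - ?q j z) / S j) \<le> m ^ n" for j
      using one_minus_branch_n_le[of "S j" n x] S(2,3)[of j] q
      by (intro AE_pmfI) (simp add: divide_le_eq)
  qed (use Suc.IH in auto)
  also have "mean_op (\<lambda>z. m ^ n * pmf (nstep P n z) x) y = m ^ n * pmf (nstep P (Suc n) y) x"
    by (simp add: pmf_bind)
  finally have d: "d \<longlonglongrightarrow> m ^ n * pmf (nstep P (Suc n) y) x" .
  have mq: "mean_op (?q j) y = 1 - S j * d j" for j
    using dq[of j] iq(3)[of j] by simp
  have "(\<lambda>j. 1 - S j * d j) \<longlonglongrightarrow> 1 - 0 * (m ^ n * pmf (nstep P (Suc n) y) x)"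
    by (intro tendsto_intros S d)
  then have "(\<lambda>j. mean_op (?q j) y) \<longlonglongrightarrow> 1"
    by (simp add: mq)
  then have "(\<lambda>j. gf_slope (\<mu> y) (mean_op (?q j) y)) \<longlonglongrightarrow> measure_pmf.expectation (\<mu> y) real"
    by (rule gf_slope_tendsto_mean[OF integrable_offspring]) (rule iq)+
  then have slope: "(\<lambda>j. gf_slope (\<mu> y) (mean_op (?q j) y)) \<longlonglongrightarrow> m"
    by (simp add: expectation_offspring)
  have "(1 - branch_n (Suc n) (\<lambda>z. 1 - S j * indicator {x} z) y) / S j =
      d j * gf_slope (\<mu> y) (mean_op (?q j) y)" for j
    using one_minus_branch[of "?q j" y] q dq[of j] S(2)[of j] by simp
  then show ?case using tendsto_mult[OF d slope] by (simp add: mult_ac)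
qed

lemma infinite_visits_positive:
  assumes "1 < m ^ N * pmf (nstep P N x) x"
  shows "finite_visits_prob P \<mu> x x < 1"
proof -
  define S where "S j = inverse (real (Suc j))" for j
  have S: "S \<longlonglongrightarrow> 0" "\<And>j. 0 < S j" "\<And>j. S j \<le> 1"
    unfolding S_def using LIMSEQ_inverse_real_of_nat by (auto simp: field_simps)
  let ?f = "\<lambda>\<delta> z. 1 - \<delta> * indicator {x} z :: real"
  have "eventually (\<lambda>j. 1 < (1 - branch_n N (?f (S j)) x) / S j) sequentially"
    by (rule order_tendstoD(1)[OF branch_n_linearisation[OF S] assms])
  then obtain j where j: "1 < (1 - branch_n N (?f (S j)) x) / S j"
    by (auto simp: eventually_sequentially)
  define \<delta> where "\<delta> = S j"
  have \<delta>: "0 < \<delta>" "\<delta> \<le> 1" using S by (auto simp: \<delta>_def)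
  have f: "0 \<le> ?f \<delta> z" "?f \<delta> z \<le> 1" "0 \<le> ?f 1 z" "?f 1 z \<le> ?f \<delta> z" for z
    using \<delta> by (auto simp: indicator_def)
  \<comment> \<open>At \<open>x\<close> the difference quotient exceeds 1 by the choice of \<delta>;
    at every other site the right-hand side is 1.\<close>
  have invariant: "branch_n N (?f \<delta>) z \<le> ?f \<delta> z" for z
    using j \<delta> branch_n_unit_interval(2)[of "?f \<delta>" N z] f
    by (cases "z = x") (auto simp: \<delta>_def[symmetric] less_divide_eq)
  have iterate: "branch_n (k * N) (?f 1) z \<le> ?f \<delta> z" for k z
  proof (induction k arbitrary: z)
    case 0
    show ?case using f(4) by simp
  next
    case (Suc k)
    have "branch_n (Suc k * N) (?f 1) z = branch_n N (branch_n (k * N) (?f 1)) z"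
      by (simp add: funpow_add)
    also have "\<dots> \<le> branch_n N (?f \<delta>) z"
      by (intro branch_n_mono Suc.IH f branch_n_unit_interval) (simp add: indicator_def)
    also have "\<dots> \<le> ?f \<delta> z" by (rule invariant)
    finally show ?case .
  qed
  have *: "avoid_prob P \<mu> x {k * N} x \<le> 1 - \<delta>" for k
    using iterate[of k x] by (simp add: avoid_prob_single)
  \<comment> \<open>This makes n N \<ge> n, so that the time n N belongs to the tail starting at
    \<open>n\<close>.\<close>
  have "N \<noteq> 0"
  proof
    assume "N = 0"
    with assms show False by (simp add: indicator_def split: if_splits)
  qed
  have "avoid_prob P \<mu> x {n..} x \<le> 1 - \<delta>" for n
  proof -
    have "avoid_prob P \<mu> x {n..} x \<le> avoid_prob P \<mu> x {n * N} x"
      by (rule avoid_prob_antimono) (use \<open>N \<noteq> 0\<close> in auto)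
    then show ?thesis using *[of n] by linarith
  qed
  then have "finite_visits_prob P \<mu> x x \<le> 1 - \<delta>"
    by (intro LIMSEQ_le_const2[OF avoid_prob_tail_tendsto]) blast
  then show ?thesis using \<delta> by linarith
qed

section \<open>From almost sure infinite return at one site to all sites\<close>

lemma recurrent_from_everywhere:
  assumes "finite_visits_prob P \<mu> x x = 0"
  shows "finite_visits_prob P \<mu> x y = 0"
  using irreducible
proof (induction rule: irreducible_kernel_induct[of P _ x])
  case base
  show ?case by (rule assms)
next
  case (step y z)
  \<comment> \<open>A generating function vanishes at most at 0, so the zero at \<open>y\<close>
    passes to the mean over its successors and thus to each of them.\<close>
  have "mean_op (finite_visits_prob P \<mu> x) y = 0"
  proof (rule offspring_gf_eq_0)
    show "offspring_gf (\<mu> y) (mean_op (finite_visits_prob P \<mu> x) y) = 0"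
      using step(1) finite_visits_prob_step[of P \<mu> x y] by (simp add: branch_def)
  qed (auto intro!: expectation_unit_interval)
  then have "AE w in P y. finite_visits_prob P \<mu> x w = 0"
    by (subst (asm) integral_nonneg_eq_0_iff_AE) (auto intro!: expectation_unit_interval)
  then show ?case using step(2) by (simp add: AE_measure_pmf_iff)
qed

text \<open>Every line of descent that reaches \<open>x\<close> restarts there, so the worst chance of avoiding \<open>y\<close>
  is attained at \<open>x\<close>.\<close>

lemma avoid_prob_le_at_recurrent:
  fixes x y :: 'a
  assumes "\<And>z. finite_visits_prob P \<mu> x z = 0"
  shows "avoid_prob P \<mu> y {1..} z \<le> avoid_prob P \<mu> y {1..} x"
proof -
  define u where "u = avoid_prob P \<mu> y {1..}"
  let ?r = "\<lambda>n. avoid_prob P \<mu> x {1..n}"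
  have u: "0 \<le> u z" "u z \<le> 1" for z by (auto simp: u_def)
  have convex1: "a + (1 - a) * b \<le> 1" if "a \<le> 1" "b \<le> 1" for a b :: real
    using mult_left_le[of b "1 - a"] that by simp
  \<comment> \<open>An interpolation between \<open>u x\<close>, if \<open>x\<close> is hit within
    \<open>n\<close> steps, and the trivial bound 1, if it is not.\<close>
  have bound: "u z \<le> u x + (1 - u x) * ?r n z" for n z
  proof (induction n arbitrary: z)
    case 0
    interpret prob_space "bmc_space P \<mu>" by (rule prob_space_bmc)
    show ?case using prob_space u by (simp add: avoid_prob_def avoids_def)
  next
    case (Suc n)
    let ?q = "\<lambda>w. if w = x then 0 else ?r n w"
    note q = expectation_unit_interval[of ?q "P z"]
    have "u z = branch P \<mu> (\<lambda>w. if w = y then 0 else u w) z"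
      unfolding u_def by (rule avoid_prob_forever_step)
    \<comment> \<open>At w = x the right-hand side is \<open>u x\<close>, the value after a restart;
      elsewhere it is the induction hypothesis.\<close>
    also have "\<dots> \<le> branch P \<mu> (\<lambda>w. u x + (1 - u x) * ?q w) z"
      by (rule branch_mono) (use u Suc.IH in \<open>auto intro!: convex1\<close>)
    also have "\<dots> = offspring_gf (\<mu> z) (u x + (1 - u x) * mean_op ?q z)"
      using q(3) by (simp add: branch_def)
    also have "\<dots> \<le> u x + (1 - u x) * offspring_gf (\<mu> z) (mean_op ?q z)"
      using q u by (intro offspring_gf_convex) auto
    also have "offspring_gf (\<mu> z) (mean_op ?q z) = ?r (Suc n) z"
      unfolding avoid_prob_segment_step by (simp add: branch_def)
    finally show ?case .
  qed
  have "avoid_prob P \<mu> x {1..} z = 0"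
    using avoid_prob_tail_le[of P \<mu> x 1 z] assms[of z] avoid_prob_nonneg[of P \<mu> x "{1..}" z] by linarith
  then have "(\<lambda>n. ?r n z) \<longlonglongrightarrow> 0"
    using avoid_prob_segment_tendsto[of P \<mu> x z] by simp
  then have "(\<lambda>n. u x + (1 - u x) * ?r n z) \<longlonglongrightarrow> u x + (1 - u x) * 0"
    by (intro tendsto_intros)
  then have "u z \<le> u x + (1 - u x) * 0"
    by (rule LIMSEQ_le_const) (use bound in blast)
  then show ?thesis by (simp add: u_def)
qed

text \<open>The chance \<open>u\<close> of avoiding \<open>y\<close> is maximal at \<open>x\<close>.
  Having at least one child gives u(x) \<le> (P q)(x), where \<open>q\<close> is \<open>u\<close>
  set to 0 at \<open>y\<close>; hence u(x) \<le> u(x) (1 - p(x, y)), and u vanishes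
  identically.\<close>

lemma recurrence_step:
  assumes x: "\<And>z. finite_visits_prob P \<mu> x z = 0" and y: "y \<in> set_pmf (P x)"
  shows "finite_visits_prob P \<mu> y z = 0"
proof -
  define u where "u = avoid_prob P \<mu> y {1..}"
  let ?q = "\<lambda>w. if w = y then 0 else u w"
  have u: "0 \<le> u z" "u z \<le> 1" "u z \<le> u x" for z
    using avoid_prob_le_at_recurrent[OF x] by (auto simp: u_def)
  have u_step: "u z = branch P \<mu> ?q z" for z
    unfolding u_def by (rule avoid_prob_forever_step)
  have q: "0 \<le> mean_op ?q x" "mean_op ?q x \<le> 1" "integrable (P x) ?q"
    by (rule expectation_unit_interval; use u in simp)+
  have "u x \<le> mean_op ?q x"
    unfolding u_step[of x] branch_def
    using offspring_gf_le_self[OF no_death q(1,2)] by simp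
  also have "\<dots> \<le> mean_op (\<lambda>w. u x - u x * indicator {y} w) x"
    by (intro integral_mono q integrable_pmf_bounded[where B = 1])
      (use u in \<open>auto simp: indicator_def\<close>)
  also have "\<dots> = u x - u x * pmf (P x) y"
    by (simp add: pmf.rep_eq integrable_pmf_bounded[where B = 1])
  finally have "u x * pmf (P x) y \<le> 0" by simp
  then have "u x = 0"
    using pmf_positive[OF y] u(1)[of x] by (simp add: mult_le_0_iff)
  then have u0: "u z = 0" for z using u[of z] by simp
  \<comment> \<open>A visit after time 0 is certain from every start. As no particle dies childless,
    \<open>branch\<close> maps 0 to 0, so a visit after any later time is certain too.\<close>
  have "avoid_prob P \<mu> y {Suc n..} z = 0" for n z
  proof (induction n arbitrary: z)
    case 0
    show ?case using u0 by (simp add: u_def)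
  next
    case (Suc n)
    show ?case
      unfolding avoid_prob_tail_step[of _ _ _ "Suc n"] branch_def Suc.IH
      using offspring_gf_le_self[OF no_death, of 0 z] offspring_gf_nonneg[of 0 "\<mu> z"] by simp
  qed
  then have "(\<lambda>n. avoid_prob P \<mu> y {Suc n..} z) \<longlonglongrightarrow> 0" by simp
  then show ?thesis
    using LIMSEQ_Suc[OF avoid_prob_tail_tendsto[of P \<mu> y z]] LIMSEQ_unique by blast
qed

text \<open>\<open>recurrent_from_everywhere\<close> frees the starting point;
  \<open>recurrence_step\<close> then moves the target along transitions.\<close>

lemma strongly_recurrent:
  assumes "finite_visits_prob P \<mu> x x = 0"
  shows "finite_visits_prob P \<mu> y z = 0"
proof -
  have "\<forall>z. finite_visits_prob P \<mu> y z = 0"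
    using irreducible
  proof (induction rule: irreducible_kernel_induct[of P _ x])
    case base
    show ?case using recurrent_from_everywhere[OF assms] by blast
  next
    case (step v w)
    then show ?case using recurrence_step by blast
  qed
  then show ?thesis by blast
qed

end

theorem theorem3p2:
  fixes P :: "'a::countable \<Rightarrow> 'a pmf"
    and \<mu> :: "'a \<Rightarrow> nat pmf"
    and m :: real
    and x\<^sub>0 y\<^sub>0 :: 'a
  assumes "irreducible_kernel P"
    and "\<And>x. pmf (\<mu> x) 0 = 0"
    and "\<And>x. (\<lambda>k. real k * pmf (\<mu> x) k) sums m"
    and "1 < m"
  shows "(m \<le> 1 / spectral_radius P x\<^sub>0 y\<^sub>0 \<longrightarrow> bmc_transient P \<mu>) \<and>
         (m > 1 / spectral_radius P x\<^sub>0 y\<^sub>0 \<longrightarrow> bmc_recurrent P \<mu>)"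
proof -
  interpret branching_chain P \<mu> m
    by unfold_locales (fact assms)+
  \<comment> \<open>Needed to multiply the two hypotheses out, as division by 0 would give
    0.\<close>
  have \<rho>: "0 < spectral_radius P x\<^sub>0 y\<^sub>0" by (rule spectral_radius_pos[OF irreducible])
  show ?thesis
  proof (intro conjI impI)
    assume "m \<le> 1 / spectral_radius P x\<^sub>0 y\<^sub>0"
    then have "m * spectral_radius P x\<^sub>0 y\<^sub>0 \<le> 1" using \<rho> by (simp add: le_divide_eq)
    then show "bmc_transient P \<mu>"
      unfolding bmc_transient_def inf_return_prob_eq using finite_visits_almost_surely by simp
  next
    assume "m > 1 / spectral_radius P x\<^sub>0 y\<^sub>0"
    then have "1 / m < spectral_radius P x\<^sub>0 y\<^sub>0"
      using \<rho> m_gt_1 by (simp add: divide_less_eq mult.commute)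
    then have pos: "finite_visits_prob P \<mu> x x < 1" for x
      using exists_supercritical_return[OF irreducible m_gt_1] infinite_visits_positive by metis
    \<comment> \<open>All return probabilities are positive. If one of them is 1, they all are;
      otherwise all lie strictly between 0 and 1.\<close>
    show "bmc_recurrent P \<mu>"
    proof (cases "\<exists>x. finite_visits_prob P \<mu> x x = 0")
      case True
      then show ?thesis
        unfolding bmc_recurrent_def inf_return_prob_eq using strongly_recurrent by auto
    next
      case False
      then have "0 < finite_visits_prob P \<mu> x x" for x
        using finite_visits_prob_nonneg[of P \<mu> x x] by (metis order_le_less)
      then show ?thesis
        unfolding bmc_recurrent_def inf_return_prob_eq using pos by simp
    qed
  qed
qed

end
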